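(* Let $\lambda\in(0,1]$, let $F$ be a $\lambda$-regular distribution, and let $n\ge 2$ be an integer. Then $$\mathrm{APX}(F,n)\le\frac{1}{\sup_{c\in[0,1]}g_{n,\lambda}(c)}+a_{n,\lambda},$$ where $$g_{n,\lambda}(c)=c\left[1-\left[1-\left[1+c(\beta_{n,\lambda}-1)\right]^{-1/\lambda}\right]^n\right],\qquad \beta_{n,\lambda}=\frac{n!\,\Gamma(2-\lambda)}{\Gamma(n+1-\lambda)}=\prod_{k=2}^n\left(1-\frac{\lambda}{k}\right)^{-1},$$ and $$a_{n,\lambda}=\begin{cases}\dfrac{(1-\lambda)^{1/\lambda}\left[1-(1-\lambda)^{1/\lambda}\right]^{n-1}}{1-\left[1-(1-\lambda)^{1/\lambda}\right]^n},&\lambda\in(0,1),\\[2mm] \dfrac1n,&\lambda=1.\end{cases}$$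
   Context: $F$ is the cdf of a continuous (absolutely continuous) probability distribution with pdf $f$, supported on an interval $D_F\subseteq[0,\infty)$. For $\lambda\in(0,1]$, $F$ is $\lambda$-regular if $\phi_\lambda(x)=\lambda x-\frac{1-F(x)}{f(x)}$ is nondecreasing on $D_F$; equivalently $(1-F(x))^{-\lambda}$ is convex. For $n\ge 2$ bidders with i.i.d. valuations from $F$, let $X_{1:n}\le\dots\le X_{n:n}$ be the order statistics of $n$ i.i.d. draws from $F$. $\mathrm{Myerson}(F,n)$ denotes the maximum expected revenue achievable by any (truthful) auction; by Myerson's theorem, for these distributions it equals the best expected revenue of a second-price auction with reserve, $\mathrm{Myerson}(F,n)=\sup_{p\ge0}\mathbb{E}\left[\max\{p,X_{n-1:n}\}\mathbf 1\{X_{n:n}\ge p\}\right]$. The optimal anonymous pricing revenue is $\mathrm{Price}(F,n)=\sup_{p\in D_F}p\,(1-F(p)^n)$, and $\mathrm{APX}(F,n)=\mathrm{Myerson}(F,n)/\mathrm{Price}(F,n)$. $\Gamma$ is the gamma function. *)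

theory Defs
  imports "HOL-Probability.Probability"
begin

text \<open>
  A distribution is represented by its probability measure \<open>M\<close> on the reals, its cdf being
  \<open>cdf M\<close>. Requiring \<open>f > 0\<close> on all of \<open>D\<close> makes the quotient in \<open>virtual_value\<close> meaningful
  there. As \<open>D\<close> may be open, half-open or closed, an endpoint at which the density vanishes
  can be left out of \<open>D\<close>.
\<close>

definition has_pdf_on :: "real measure \<Rightarrow> (real \<Rightarrow> real) \<Rightarrow> real set \<Rightarrow> bool" where
  "has_pdf_on M f D \<longleftrightarrow>
     prob_space M \<and> f \<in> borel_measurable borel \<and> M = density lborel (\<lambda>x. ennreal (f x)) \<and>
     is_interval D \<and> D \<subseteq> {0..} \<and> (\<forall>x\<in>D. f x > 0) \<and> (\<forall>x. x \<notin> D \<longrightarrow> f x = 0)"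

definition virtual_value :: "real \<Rightarrow> real measure \<Rightarrow> (real \<Rightarrow> real) \<Rightarrow> real \<Rightarrow> real" where
  "virtual_value lam M f x = lam * x - (1 - cdf M x) / f x"

definition lambda_regular :: "real \<Rightarrow> real measure \<Rightarrow> (real \<Rightarrow> real) \<Rightarrow> real set \<Rightarrow> bool" where
  "lambda_regular lam M f D \<longleftrightarrow> has_pdf_on M f D \<and> mono_on D (virtual_value lam M f)"

text \<open>
  A direct single-item auction for the bidders \<open>i < n\<close>: at the bid profile \<open>v\<close>, bidder \<open>i\<close>
  wins with probability \<open>x v i\<close> and makes the (expected) payment \<open>p v i\<close>. The last two
  conjuncts are dominant-strategy incentive compatibility and individual rationality, with \<open>D\<close>
  as the type space of each bidder. Payments may be negative; integrability of their
  total makes the expected revenue well defined.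
\<close>

definition valuations :: "real measure \<Rightarrow> nat \<Rightarrow> (nat \<Rightarrow> real) measure" where
  "valuations M n = PiM {..<n} (\<lambda>_. M)"

definition truthful_auction ::
  "real measure \<Rightarrow> real set \<Rightarrow> nat \<Rightarrow>
     ((nat \<Rightarrow> real) \<Rightarrow> nat \<Rightarrow> real) \<Rightarrow> ((nat \<Rightarrow> real) \<Rightarrow> nat \<Rightarrow> real) \<Rightarrow> bool" where
  "truthful_auction M D n x p \<longleftrightarrow>
     (\<forall>i<n. (\<lambda>v. x v i) \<in> borel_measurable (valuations M n) \<and>
            (\<lambda>v. p v i) \<in> borel_measurable (valuations M n)) \<and>
     integrable (valuations M n) (\<lambda>v. \<Sum>i<n. p v i) \<and>
     (\<forall>v \<in> {..<n} \<rightarrow>\<^sub>E D. (\<forall>i<n. 0 \<le> x v i) \<and> (\<Sum>i<n. x v i) \<le> 1) \<and>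
     (\<forall>v \<in> {..<n} \<rightarrow>\<^sub>E D. \<forall>i<n. \<forall>b\<in>D.
        v i * x (v(i := b)) i - p (v(i := b)) i \<le> v i * x v i - p v i) \<and>
     (\<forall>v \<in> {..<n} \<rightarrow>\<^sub>E D. \<forall>i<n. 0 \<le> v i * x v i - p v i)"

definition expected_revenue ::
  "real measure \<Rightarrow> nat \<Rightarrow> ((nat \<Rightarrow> real) \<Rightarrow> nat \<Rightarrow> real) \<Rightarrow> real" where
  "expected_revenue M n p = (\<integral>v. (\<Sum>i<n. p v i) \<partial>valuations M n)"

definition Myerson :: "real measure \<Rightarrow> real set \<Rightarrow> nat \<Rightarrow> ereal" where
  "Myerson M D n = (SUP (x, p) \<in> {(x, p). truthful_auction M D n x p}.
     ereal (expected_revenue M n p))"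

definition Price :: "real measure \<Rightarrow> real set \<Rightarrow> nat \<Rightarrow> ereal" where
  "Price M D n = (SUP p\<in>D. ereal (p * (1 - cdf M p ^ n)))"

definition APX :: "real measure \<Rightarrow> real set \<Rightarrow> nat \<Rightarrow> ereal" where
  "APX M D n = Myerson M D n / Price M D n"

definition beta_coeff :: "nat \<Rightarrow> real \<Rightarrow> real" where
  "beta_coeff n lam = fact n * Gamma (2 - lam) / Gamma (real n + 1 - lam)"

lemma beta_coeff_eq_prod:
  assumes "lam \<le> 1" "1 \<le> n"
  shows "beta_coeff n lam = (\<Prod>k=2..n. inverse (1 - lam / real k))"
  using assms(2)
proof (induction n rule: dec_induct)
  case base
  have "Gamma (2 - lam) > 0" by (rule Gamma_real_pos) (use assms(1) in simp)
  then show ?case by (simp add: beta_coeff_def)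
next
  case (step n)
  have pos: "real n + 1 - lam > 0" using assms(1) step by simp
  have "Gamma (real (Suc n) + 1 - lam) = Gamma ((real n + 1 - lam) + 1)"
    by (simp add: algebra_simps)
  also have "\<dots> = (real n + 1 - lam) * Gamma (real n + 1 - lam)"
    by (rule Gamma_plus1) (use pos in \<open>auto elim!: nonpos_Ints_cases\<close>)
  finally have "beta_coeff (Suc n) lam = beta_coeff n lam * ((real n + 1) / (real n + 1 - lam))"
    by (simp add: beta_coeff_def algebra_simps)
  also have "(real n + 1) / (real n + 1 - lam) = inverse (1 - lam / real (Suc n))"
    using pos by (simp add: field_simps)
  finally show ?case using step by simp
qed

definition g_fun :: "nat \<Rightarrow> real \<Rightarrow> real \<Rightarrow> real" where
  "g_fun n lam c = c * (1 - (1 - (1 + c * (beta_coeff n lam - 1)) powr (- 1 / lam)) ^ n)"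

definition a_coeff :: "nat \<Rightarrow> real \<Rightarrow> real" where
  "a_coeff n lam =
     (if lam = 1 then 1 / real n
      else (1 - lam) powr (1 / lam) * (1 - (1 - lam) powr (1 / lam)) ^ (n - 1)
             / (1 - (1 - (1 - lam) powr (1 / lam)) ^ n))"

end

(* Let mu be the expected second-highest value and phi the virtual value x - (1 - F x) / f x.
   Truthful payments are at most the virtual surplus, so Myerson is at most
   n E[max 0 (phi X) F(X)^(n-1)] = mu + n E[max 0 (- phi X) F(X)^(n-1)].

   The first summand: G = (1 - F)^(-lam) is convex, and E[G] at the second-highest value is
   E[U^(-lam)] = beta for the quantile U ~ Beta(2, n-1). Convexity and Jensen give
   G(c mu) <= 1 + c (beta - 1), so posting the price c mu earns at least g(c) mu.

   The second summand: let p be the monopoly reserve. As - phi decreases and F increases below p,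
   Chebyshev's inequality bounds it by F(p)^(n-1) E[max 0 (- phi X)] <= p (1 - F p) F(p)^(n-1), where
   1 - F p >= (1 - lam)^(1/lam) by regularity. Relative to the revenue p (1 - F(p)^n) at the price p
   this is largest for the smallest such 1 - F p, which gives a.

   For lam = 1 single payments and phi X need not be integrable. All of this is therefore applied to
   F conditioned on values at most T, which preserves regularity and does not increase the price
   revenue, and then T tends to infinity. *)

theory Submission
  imports Defs
begin

section \<open>Distributions with a density\<close>

text \<open>As \<open>f\<close> is only measurable, \<open>F\<close> need not be differentiable at a
  given point, so neither convexity nor integration by parts comes from differentiating
  \<open>F\<close>. The uniform law of \<open>F X\<close> replaces both: integrals of functions of
  \<open>F\<close> become Lebesgue integrals over quantiles, where the fundamental theorem applies,
  and a factor \<open>x\<close> is resolved into layers. The interval \<open>D\<close> may lack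
  either endpoint; what happens near a missing endpoint is reached through limits or at the cost of
  an arbitrarily small error. The truncation acts on all bids at once. An auction only guarantees
  that the total payment is integrable, and when every bid is at most \<open>T\<close>, individual
  rationality bounds each payment from above, which makes the single payments integrable too.
  Restricting the incentive argument to values up to \<open>T\<close> replaces the mass above a type
  \<open>y\<close> by \<open>F T - F y\<close>, so the virtual value of the conditioned law appears
  by itself. Conditioning divides the cdf by \<open>F T\<close>; this leaves a factor
  \<open>F T ^ n\<close> in the revenue bound, which is at most 1.\<close>

locale pdf_dist =
  fixes M :: "real measure" and f :: "real \<Rightarrow> real" and D :: "real set"
  assumes pdf: "has_pdf_on M f D"
begin

abbreviation F :: "real \<Rightarrow> real" where "F \<equiv> cdf M"

lemma f_measurable [measurable]: "f \<in> borel_measurable borel"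
  and M_eq: "M = density lborel (\<lambda>x. ennreal (f x))"
  and interval_D: "is_interval D"
  and D_nonneg: "x \<in> D \<Longrightarrow> 0 \<le> x"
  and f_pos: "x \<in> D \<Longrightarrow> 0 < f x"
  and f_zero: "x \<notin> D \<Longrightarrow> f x = 0"
  using pdf by (auto simp: has_pdf_on_def)

lemma f_nonneg: "0 \<le> f x"
  using f_pos[of x] f_zero[of x] by (cases "x \<in> D") auto

sublocale real_distribution M
proof -
  have "prob_space M" using pdf unfolding has_pdf_on_def by blast
  moreover have "sets M = sets borel" by (subst M_eq) simp
  ultimately show "real_distribution M"
    by (simp add: real_distribution_def real_distribution_axioms_def)
qed

lemma sets_eq [measurable_cong]: "sets M = sets borel"
  by (subst M_eq) simp

lemma D_sets [measurable]: "D \<in> sets borel"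
proof -
  have "D = {x. 0 < f x}" using f_pos f_zero by force
  also have "\<dots> \<in> sets borel" by measurable
  finally show ?thesis .
qed

lemma AE_D: "AE x in M. x \<in> D"
proof -
  have "AE x in density lborel (\<lambda>x. ennreal (f x)). x \<in> D"
    by (subst AE_density) (use f_zero in \<open>auto intro!: AE_I2, metis less_irrefl\<close>)
  thus ?thesis by (subst M_eq)
qed

lemma F_mono: "x \<le> y \<Longrightarrow> F x \<le> F y" by (rule cdf_nondecreasing)
lemma F_ge0: "0 \<le> F x" by (rule cdf_nonneg)
lemma F_le1: "F x \<le> 1" by (rule cdf_bounded_prob)

lemma F_measurable [measurable]: "F \<in> borel_measurable borel"
  by (rule borel_measurable_mono) (auto simp: mono_def F_mono)

lemma AE_neq: "AE y in M. y \<noteq> x"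
proof -
  have "AE y in density lborel (\<lambda>x. ennreal (f x)). y \<noteq> x"
    by (subst AE_density) (use AE_lborel_singleton[of x] in auto)
  thus ?thesis by (subst M_eq)
qed

lemma measure_singleton: "measure M {x} = 0"
  by (subst prob_eq_0) (use AE_neq[of x] in auto)

lemma isCont_F: "isCont F x"
  using isCont_cdf measure_singleton by blast

lemma measure_Ioc: "a \<le> b \<Longrightarrow> measure M {a<..b} = F b - F a"
  using cdf_diff_eq[of a b] by (cases "a = b") auto

lemma nn_integral_M:
  "g \<in> borel_measurable borel \<Longrightarrow> (\<integral>\<^sup>+x. g x \<partial>M) = (\<integral>\<^sup>+x. ennreal (f x) * g x \<partial>lborel)"
  by (subst M_eq, subst nn_integral_density) auto

lemma F_eq0: assumes "\<And>d. d \<in> D \<Longrightarrow> t \<le> d" shows "F t = 0"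
proof -
  have "AE x in M. x \<notin> {..t}"
    using AE_neq[of t] AE_D by eventually_elim (use assms in force)
  hence "measure M {..t} = 0" by (subst prob_eq_0) auto
  thus ?thesis by (simp add: cdf_def2)
qed

lemma F_eq1: assumes "\<And>d. d \<in> D \<Longrightarrow> d \<le> t" shows "F t = 1"
proof -
  have "AE x in M. x \<in> {..t}" using AE_D by eventually_elim (use assms in auto)
  hence "measure M {..t} = 1" by (subst prob_eq_1) auto
  thus ?thesis by (simp add: cdf_def2)
qed

lemma mem_D: assumes "0 < F t" "F t < 1" shows "t \<in> D"
proof -
  obtain d where "d \<in> D" "d < t" using F_eq0[of t] assms(1) by force
  moreover obtain e where "e \<in> D" "t < e" using F_eq1[of t] assms(2) by force
  ultimately show ?thesis using interval_D unfolding is_interval_1 by (meson less_imp_le)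
qed

lemma F_strict: assumes "s \<in> D" "t \<in> D" "s < t" shows "F s < F t"
proof (rule ccontr)
  assume "\<not> F s < F t"
  hence "measure M {s<..t} = 0" using F_mono[of s t] assms measure_Ioc[of s t] by simp
  hence "emeasure M {s<..t} = 0" by (simp add: emeasure_eq_measure)
  hence "(\<integral>\<^sup>+x. ennreal (f x) * indicator {s<..t} x \<partial>lborel) = 0"
    using nn_integral_M[of "indicator {s<..t}"] by simp
  hence "AE x in lborel. ennreal (f x) * indicator {s<..t} x = 0"
    by (subst (asm) nn_integral_0_iff_AE) auto
  hence "AE x in lborel. x \<notin> {s<..t}"
  proof eventually_elim
    case (elim x)
    show ?case
    proof
      assume "x \<in> {s<..t}"
      hence "x \<in> D" using assms interval_D unfolding is_interval_1 by (meson greaterThanAtMost_iff less_imp_le)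
      thus False using elim f_pos[of x] \<open>x \<in> {s<..t}\<close> by (simp add: ennreal_eq_0_iff)
    qed
  qed
  hence "emeasure lborel {s<..t} = 0" by (subst (asm) AE_iff_measurable[of "{s<..t}"]) auto
  thus False using assms by simp
qed

lemma ex_quantile: assumes "0 < u" "u < 1" shows "\<exists>t\<in>D. F t = u"
proof -
  have "\<forall>\<^sub>F x in at_top. u < F x"
    using order_tendstoD(1)[OF cdf_lim_at_top_prob assms(2)] .
  then obtain b where b: "u < F b" by (auto dest: eventually_happens)
  have "\<forall>\<^sub>F x in at_bot. F x < u"
    using order_tendstoD(2)[OF cdf_lim_at_bot assms(1)] .
  then obtain a where a: "F a < u" by (auto dest: eventually_happens)
  have "a \<le> b" using a b F_mono[of b a] by linarith
  then obtain t where "F t = u"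
    using IVT[of F a u b] a b isCont_F by auto
  thus ?thesis using mem_D[of t] assms by auto
qed

section \<open>The quantile transform\<close>

lemma prob_F_le: assumes "0 < u" "u < 1" shows "measure M {x. F x \<le> u} = u"
proof -
  obtain t where t: "t \<in> D" "F t = u" using ex_quantile assms by blast
  have "measure M {x. F x \<le> u} = measure M {..t}"
  proof (rule measure_eq_AE)
    show "AE x in M. (x \<in> {x. F x \<le> u}) = (x \<in> {..t})"
      using AE_D
    proof eventually_elim
      case (elim x)
      show ?case using F_mono[of x t] F_strict[OF t(1) elim] t by force
    qed
  qed auto
  thus ?thesis using t by (simp add: cdf_def2)
qed

text \<open>The probability integral transform. It permits the substitution \<open>u = F x\<close>
  without differentiating \<open>F\<close>.\<close>

lemma F_uniform: "distributed M lborel F (\<lambda>u. ennreal (indicator {0..1} u))"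
proof -
  have "prob {x. F x \<le> u} = u" if u: "u \<in> {0..1}" for u
  proof -
    consider "u = 0" | "u = 1" | "0 < u" "u < 1" using u by force
    thus ?thesis
    proof cases
      case 1
      \<comment> \<open>There need be no point of \<open>D\<close> with \<open>F\<close> equal to 0,
        so level 0 is squeezed below the levels \<open>e > 0\<close>; half the supposed probability
        serves as \<open>e\<close>.\<close>
      have small: "prob {x. F x \<le> 0} \<le> e" if "0 < e" "e < 1" for e
      proof -
        have "prob {x. F x \<le> 0} \<le> prob {x. F x \<le> e}"
          using that by (intro finite_measure_mono) auto
        thus ?thesis using prob_F_le that by simp
      qed
      have "prob {x. F x \<le> 0} \<le> 0" 
        using small[of "prob {x. F x \<le> 0} / 2"] prob_le_1[of "{x. F x \<le> 0}"]
        by (cases "0 < prob {x. F x \<le> 0}") auto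
      thus ?thesis using 1 measure_nonneg[of M "{x. F x \<le> 0}"] by simp
    next
      case 2
      thus ?thesis using F_le1 prob_space by simp
    qed (simp add: prob_F_le)
  qed
  hence "distributed M lborel F (\<lambda>x. indicator {0..1} x / measure lborel {0..1::real})"
    by (subst uniform_distributed_iff) (auto simp: vimage_def)
  thus ?thesis by (simp add: measure_def)
qed

lemma nn_integral_F:
  assumes [measurable]: "k \<in> borel_measurable borel"
  shows "(\<integral>\<^sup>+x. k (F x) \<partial>M) = (\<integral>\<^sup>+u. k u * indicator {0..1} u \<partial>lborel)"
  using distributed_nn_integral[OF F_uniform, of k]
  by (simp add: mult.commute ennreal_indicator)

lemma AE_F01: "AE x in M. 0 < F x \<and> F x < 1"
proof -
  have "(\<integral>\<^sup>+x. indicator (- {0<..<1}) (F x) \<partial>M) = 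
     (\<integral>\<^sup>+u. indicator (- {0<..<1::real}) u * indicator {0..1} u \<partial>lborel)"
    by (rule nn_integral_F) auto
  also have "\<dots> = (\<integral>\<^sup>+u. indicator {0,1::real} u \<partial>lborel)"
    by (rule nn_integral_cong) (auto split: split_indicator)
  also have "\<dots> = emeasure lborel {0,1::real}" by (rule nn_integral_indicator) auto
  also have "\<dots> = 0" by (rule emeasure_lborel_countable) auto
  finally have "AE x in M. indicator (- {0<..<1}) (F x) = (0::ennreal)"
    by (subst (asm) nn_integral_0_iff_AE) auto
  thus ?thesis by eventually_elim (auto split: split_indicator_asm)
qed

text \<open>\<open>F\<close> is constant on either side of \<open>D\<close>, so the equivalence can
  fail there, but only on a null set. It turns events about values into events about
  quantiles.\<close>

lemma AE_F_le_iff: "AE x in M. F x \<le> F t \<longleftrightarrow> x \<le> t"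
  using AE_F01 AE_D
proof eventually_elim
  case (elim x)
  show ?case
  proof
    assume le: "F x \<le> F t"
    show "x \<le> t"
    proof (rule ccontr)
      assume "\<not> x \<le> t"
      moreover from this le have "F x = F t" using F_mono[of t x] by simp
      moreover from this have "t \<in> D" using elim mem_D[of t] by simp
      ultimately show False using F_strict[of t x] elim by simp
    qed
  qed (rule F_mono)
qed

lemma nn_integral_Ioc_F:
  assumes [measurable]: "k \<in> borel_measurable borel"
  shows "(\<integral>\<^sup>+x. k (F x) * indicator {s<..t} x \<partial>M) = (\<integral>\<^sup>+u. k u * indicator {F s<..F t} u \<partial>lborel)"
proof -
  have "(\<integral>\<^sup>+x. k (F x) * indicator {s<..t} x \<partial>M) = (\<integral>\<^sup>+x. k (F x) * indicator {F s<..F t} (F x) \<partial>M)"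
    using AE_F_le_iff[of s] AE_F_le_iff[of t]
    by (intro nn_integral_cong_AE, eventually_elim) (auto split: split_indicator)
  also have "\<dots> = (\<integral>\<^sup>+u. k u * indicator {F s<..F t} u * indicator {0..1} u \<partial>lborel)"
    by (rule nn_integral_F) measurable
  also have "\<dots> = (\<integral>\<^sup>+u. k u * indicator {F s<..F t} u \<partial>lborel)"
    using F_ge0[of s] F_le1[of t] by (intro nn_integral_cong) (auto split: split_indicator)
  finally show ?thesis .
qed

text \<open>Layer cake: a value \<open>x\<close> is the length of the set of levels \<open>s\<close>
  with \<open>0 \<le> s < x\<close>, and Tonelli exchanges levels and values. This stands in for
  integration by parts against \<open>F\<close>.\<close>

lemma nn_integral_layer:
  assumes k [measurable]: "k \<in> borel_measurable borel"
  shows "(\<integral>\<^sup>+x. ennreal x * k (F x) \<partial>M) =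
    (\<integral>\<^sup>+s. (\<integral>\<^sup>+u. k u * indicator {F s<..1} u \<partial>lborel) * indicator {0..} s \<partial>lborel)"
proof -
  have "(\<integral>\<^sup>+x. ennreal x * k (F x) \<partial>M) =
      (\<integral>\<^sup>+x. (\<integral>\<^sup>+s. k (F x) * indicator {0..} s * indicator {s<..} x \<partial>lborel) \<partial>M)"
  proof (rule nn_integral_cong_AE, use AE_D in eventually_elim)
    case (elim x)
    have "(\<integral>\<^sup>+s. k (F x) * indicator {0..} s * indicator {s<..} x \<partial>lborel) =
          (\<integral>\<^sup>+s. k (F x) * indicator {0..<x} s \<partial>lborel)"
      by (rule nn_integral_cong) (auto split: split_indicator)
    also have "\<dots> = k (F x) * ennreal x"
      using D_nonneg[OF elim] by (subst nn_integral_cmult_indicator) auto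
    finally show ?case by (simp add: mult.commute)
  qed
  also have "\<dots> = (\<integral>\<^sup>+s. (\<integral>\<^sup>+x. k (F x) * indicator {0..} s * indicator {s<..} x \<partial>M) \<partial>lborel)"
  proof (rule pair_sigma_finite.Fubini')
    show "pair_sigma_finite lborel M" by (simp add: pair_sigma_finite_def sigma_finite_measure_axioms lborel.sigma_finite_measure_axioms)
    have "(\<lambda>(s,x). k (F x) * indicator {0..} s * (if s < x then 1 else 0)) \<in> borel_measurable (lborel \<Otimes>\<^sub>M M)"
      by measurable
    thus "(\<lambda>(s,x). k (F x) * indicator {0..} s * indicator {s<..} x) \<in> borel_measurable (lborel \<Otimes>\<^sub>M M)"
      by (rule measurable_cong[THEN iffD1, rotated]) (auto split: split_indicator)
  qed
  also have "\<dots> = (\<integral>\<^sup>+s. (\<integral>\<^sup>+u. k u * indicator {F s<..1} u \<partial>lborel) * indicator {0..} s \<partial>lborel)"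
  proof (rule nn_integral_cong)
    fix s :: real
    have "(\<integral>\<^sup>+x. k (F x) * indicator {0..} s * indicator {s<..} x \<partial>M) =
       (\<integral>\<^sup>+x. (k (F x) * indicator {F s<..} (F x)) * indicator {0..} s \<partial>M)"
      using AE_F_le_iff[of s]
      by (intro nn_integral_cong_AE, eventually_elim) (auto split: split_indicator)
    also have "\<dots> = (\<integral>\<^sup>+x. (k (F x) * indicator {F s<..} (F x)) \<partial>M) * indicator {0..} s"
      by (rule nn_integral_multc) measurable
    also have "(\<integral>\<^sup>+x. (k (F x) * indicator {F s<..} (F x)) \<partial>M) = (\<integral>\<^sup>+u. k u * indicator {F s<..} u * indicator {0..1} u \<partial>lborel)"
      by (rule nn_integral_F) measurable
    also have "\<dots> = (\<integral>\<^sup>+u. k u * indicator {F s<..1} u \<partial>lborel)"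
      using F_ge0[of s] by (intro nn_integral_cong) (auto split: split_indicator)
    finally show "(\<integral>\<^sup>+x. k (F x) * indicator {0..} s * indicator {s<..} x \<partial>M) =
      (\<integral>\<^sup>+u. k u * indicator {F s<..1} u \<partial>lborel) * indicator {0..} s" .
  qed
  finally show ?thesis .
qed

end

section \<open>Convexity of the regular survival function\<close>

lemma nn_integral_FTC_Ioc:
  fixes H h :: "real \<Rightarrow> real"
  assumes [measurable]: "h \<in> borel_measurable borel"
    and "\<And>x. a \<le> x \<Longrightarrow> x \<le> b \<Longrightarrow> (H has_real_derivative h x) (at x)"
    and "\<And>x. a \<le> x \<Longrightarrow> x \<le> b \<Longrightarrow> 0 \<le> h x" and "a \<le> b"
  shows "(\<integral>\<^sup>+x. ennreal (h x) * indicator {a<..b} x \<partial>lborel) = ennreal (H b - H a)"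
proof -
  have "(\<integral>\<^sup>+x. ennreal (h x) * indicator {a<..b} x \<partial>lborel) = 
      (\<integral>\<^sup>+x. ennreal (h x) * indicator {a..b} x \<partial>lborel)"
    by (rule nn_integral_cong_AE, rule AE_mp[OF AE_lborel_singleton[of a]])
       (auto split: split_indicator)
  also have "\<dots> = ennreal (H b - H a)"
    using assms by (intro nn_integral_FTC_Icc) auto
  finally show ?thesis .
qed

text \<open>Integrals of hazard rates compare logarithms. This translates such a comparison into one
  of powers; \<open>r\<close> will be the ratio of an affine function at two points.\<close>

lemma powr_neg_mono_ln:
  fixes x y :: real
  assumes "0 < lam" "0 < x" "0 < y" "0 < r" "ln r \<le> lam * ln (x / y)"
  shows "x powr (-lam) * r \<le> y powr (-lam)"
proof -
  have "ln (x powr (-lam) * r) \<le> ln (y powr (-lam))"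
    using assms by (simp add: ln_mult ln_powr ln_div algebra_simps)
  thus ?thesis using assms by (subst (asm) ln_le_cancel_iff) auto
qed

locale regular_dist = pdf_dist +
  fixes lam :: real
  assumes lam_pos: "0 < lam" and lam_le1: "lam \<le> 1"
    and mono_virtual: "mono_on D (virtual_value lam M f)"
begin

text \<open>The reciprocal of the hazard rate. Regularity says that on \<open>D\<close> it grows
  with slope at most \<open>lam\<close>. Off \<open>D\<close> it is 0 by the convention for division
  by zero.\<close>

definition psi :: "real \<Rightarrow> real" where "psi t = (1 - F t) / f t"

lemma psi_measurable [measurable]: "psi \<in> borel_measurable borel"
  unfolding psi_def by measurable

lemma psi_nonneg: "0 \<le> psi t"
  unfolding psi_def using F_le1 f_nonneg by simp

lemma psi_pos: "t \<in> D \<Longrightarrow> F t < 1 \<Longrightarrow> 0 < psi t"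
  unfolding psi_def using f_pos by simp

lemma psi_le: "s \<in> D \<Longrightarrow> t \<in> D \<Longrightarrow> s \<le> t \<Longrightarrow> psi t \<le> psi s + lam * (t - s)"
  using mono_onD[OF mono_virtual, of s t] by (simp add: psi_def virtual_value_def algebra_simps)

text \<open>Formally this integrates the derivative of \<open>- ln (1 - F)\<close>. The density is
  absorbed into \<open>M\<close>, and after passing to quantiles the integrand is
  \<open>1 / (1 - u)\<close>, whose primitive is smooth.\<close>

lemma hazard_integral:
  assumes "s \<le> t" "F t < 1"
  shows "(\<integral>\<^sup>+x. ennreal (f x / (1 - F x)) * indicator {s<..t} x \<partial>lborel) = ennreal (ln ((1 - F s) / (1 - F t)))"
proof -
  have "(\<integral>\<^sup>+x. ennreal (f x / (1 - F x)) * indicator {s<..t} x \<partial>lborel) =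
      (\<integral>\<^sup>+x. ennreal (f x) * (ennreal (1 / (1 - F x)) * indicator {s<..t} x) \<partial>lborel)"
  proof (rule nn_integral_cong)
    fix x
    have "ennreal (f x / (1 - F x)) = ennreal (f x) * ennreal (1 / (1 - F x))"
      using F_le1[of x] f_nonneg[of x] by (subst ennreal_mult[symmetric]) auto
    thus "ennreal (f x / (1 - F x)) * indicator {s<..t} x = ennreal (f x) * (ennreal (1 / (1 - F x)) * indicator {s<..t} x)"
      by (simp add: mult.assoc)
  qed
  also have "\<dots> = (\<integral>\<^sup>+x. ennreal (1 / (1 - F x)) * indicator {s<..t} x \<partial>M)"
    by (subst nn_integral_M) auto
  also have "\<dots> = (\<integral>\<^sup>+u. ennreal (1 / (1 - u)) * indicator {F s<..F t} u \<partial>lborel)"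
    by (rule nn_integral_Ioc_F) measurable
  also have "\<dots> = ennreal (- ln (1 - F t) - (- ln (1 - F s)))"
    using assms F_mono[of s t]
    by (intro nn_integral_FTC_Ioc) (auto intro!: derivative_eq_intros)
  also have "- ln (1 - F t) - (- ln (1 - F s)) = ln ((1 - F s) / (1 - F t))"
    using assms F_mono[of s t] by (simp add: ln_div)
  finally show ?thesis .
qed

lemma mem_D_between:
  assumes "t \<in> D" "t \<le> s" "F s < 1" shows "s \<in> D"
proof -
  obtain e where "e \<in> D" "s < e" using F_eq1[of s] assms by force
  thus ?thesis using assms interval_D unfolding is_interval_1 by (meson less_imp_le)
qed

lemma integral_inverse_linear:
  assumes "0 < p" "a \<le> b" "0 < p + lam * (a - t)" 
  shows "(\<integral>\<^sup>+x. ennreal (1 / (p + lam * (x - t))) * indicator {a<..b} x \<partial>lborel) =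
     ennreal (ln ((p + lam * (b - t)) / (p + lam * (a - t))) / lam)"
proof -
  have pos: "0 < p + lam * (x - t)" if "a \<le> x" for x
    using assms(3) mult_left_mono[OF that less_imp_le[OF lam_pos]] by (simp add: algebra_simps)
  have "(\<integral>\<^sup>+x. ennreal (1 / (p + lam * (x - t))) * indicator {a<..b} x \<partial>lborel) =
     ennreal (ln (p + lam * (b - t)) / lam - ln (p + lam * (a - t)) / lam)"
    using assms lam_pos pos
    by (intro nn_integral_FTC_Ioc) (auto intro!: derivative_eq_intros simp: less_imp_le)
  also have "ln (p + lam * (b - t)) / lam - ln (p + lam * (a - t)) / lam = ln ((p + lam * (b - t)) / (p + lam * (a - t))) / lam"
    using pos[of a] pos[of b] assms by (simp add: ln_div diff_divide_distrib)
  finally show ?thesis .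
qed

text \<open>The tangent line of the convex function \<open>(1 - F)\<^sup>-\<^sup>\<lambda>\<close> at \<open>t\<close>, whose slope there is
  \<open>\<lambda> (1 - F t)\<^sup>-\<^sup>\<lambda> / psi t\<close>.\<close>

lemma tangent_line:
  assumes t: "t \<in> D" "F t < 1" and s: "F s < 1"
  shows "(1 - F t) powr (-lam) * (1 + lam * (s - t) / psi t) \<le> (1 - F s) powr (-lam)"
proof -
  \<comment> \<open>By regularity this affine function lies above \<open>psi\<close> on
    \<open>D\<close> to the right of \<open>t\<close> and below it to the left. Comparing the
    integrals of \<open>1 / L\<close> and \<open>1 / psi\<close> therefore bounds
    \<open>ln (1 - F)\<close> on both sides of \<open>t\<close> in the direction required.\<close>
  define L where "L x = psi t + lam * (x - t)" for x
  have p: "0 < psi t" using psi_pos t by simp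
  have L: "1 + lam * (s - t) / psi t = L s / L t" using p by (simp add: L_def field_simps)
  \<comment> \<open>This also holds off \<open>D\<close> and where \<open>F x = 1\<close>: both
    sides are then 0 by division by zero.\<close>
  have hz: "f x / (1 - F x) = 1 / psi x" for x by (simp add: psi_def)
  consider "t \<le> s" | "s < t" "L s \<le> 0" | "s < t" "0 < L s" by linarith
  thus ?thesis
  proof cases
    case 1
    have "ennreal (ln (L s / L t) / lam) = (\<integral>\<^sup>+x. ennreal (1 / L x) * indicator {t<..s} x \<partial>lborel)"
      unfolding L_def using p 1 by (subst integral_inverse_linear) auto
    also have "\<dots> \<le> (\<integral>\<^sup>+x. ennreal (f x / (1 - F x)) * indicator {t<..s} x \<partial>lborel)"
    proof (rule nn_integral_mono)
      fix x
      have "1 / L x \<le> 1 / psi x" if "t < x" "x \<le> s"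
      proof (rule divide_left_mono)
        have F: "F x < 1" using F_mono[of x s] that s by simp
        hence x: "x \<in> D" using mem_D_between[of t x] t that by simp
        show "psi x \<le> L x" using psi_le[of t x] x t that by (simp add: L_def)
        have "0 < psi x" using psi_pos x F by simp
        moreover have "0 < L x" using \<open>psi x \<le> L x\<close> \<open>0 < psi x\<close> by linarith
        ultimately show "0 < L x * psi x" by simp
      qed simp
      thus "ennreal (1 / L x) * indicator {t<..s} x \<le> ennreal (f x / (1 - F x)) * indicator {t<..s} x"
        by (auto split: split_indicator simp: hz intro!: ennreal_leI)
    qed
    also have "\<dots> = ennreal (ln ((1 - F t) / (1 - F s)))" by (rule hazard_integral) fact+
    finally have "ln (L s / L t) / lam \<le> ln ((1 - F t) / (1 - F s))"
      using F_mono[OF 1] s by (subst (asm) ennreal_le_iff) auto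
    moreover have "0 < L s" "0 < L t" using p 1 lam_pos by (auto simp: L_def intro!: add_pos_nonneg)
    ultimately show ?thesis unfolding L using t s lam_pos
      by (intro powr_neg_mono_ln) (auto simp: field_simps)
  next
    case 2
    have "L s / L t \<le> 0" using 2 p by (simp add: L_def divide_nonpos_pos)
    thus ?thesis unfolding L by (smt (verit) mult_nonneg_nonpos powr_ge_zero)
  next
    case 3
    have "ennreal (ln ((1 - F s) / (1 - F t))) = (\<integral>\<^sup>+x. ennreal (f x / (1 - F x)) * indicator {s<..t} x \<partial>lborel)"
      by (rule hazard_integral[symmetric]) (use 3 t in auto)
    also have "\<dots> \<le> (\<integral>\<^sup>+x. ennreal (1 / L x) * indicator {s<..t} x \<partial>lborel)"
    proof (rule nn_integral_mono)
      fix x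
      have "f x / (1 - F x) \<le> 1 / L x" if "s < x" "x \<le> t"
      proof -
        have "lam * (s - t) \<le> lam * (x - t)" using that lam_pos by simp
        hence Lx: "0 < L x" using 3 by (simp add: L_def)
        \<comment> \<open>Between \<open>s\<close> and \<open>t\<close> the point may lie below
          \<open>D\<close>, where the hazard rate is 0.\<close>
        show ?thesis
        proof (cases "x \<in> D")
          case True
          have "L x \<le> psi x" using psi_le[of x t] True t that by (simp add: L_def algebra_simps)
          thus ?thesis unfolding hz using Lx by (intro divide_left_mono) auto
        qed (use Lx in \<open>simp add: f_zero\<close>)
      qed
      thus "ennreal (f x / (1 - F x)) * indicator {s<..t} x \<le> ennreal (1 / L x) * indicator {s<..t} x"
        by (auto split: split_indicator intro!: ennreal_leI)
    qed
    also have "\<dots> = ennreal (ln (L t / L s) / lam)"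
      unfolding L_def using p 3 by (subst integral_inverse_linear) (auto simp: L_def)
    finally have "ennreal (ln ((1 - F s) / (1 - F t))) \<le> ennreal (ln (L t / L s) / lam)" .
    moreover have "L s \<le> L t" using 3 lam_pos by (simp add: L_def mult_nonneg_nonpos)
    hence "0 \<le> ln (L t / L s) / lam" using 3 lam_pos by simp
    ultimately have *: "ln ((1 - F s) / (1 - F t)) \<le> ln (L t / L s) / lam"
      by (simp add: ennreal_le_iff)
    have "0 < L t" using p by (simp add: L_def)
    hence "ln (L s / L t) \<le> lam * ln ((1 - F t) / (1 - F s))"
      using * t s 3 lam_pos by (simp add: ln_div field_simps)
    thus ?thesis unfolding L using t s lam_pos p 3
      by (intro powr_neg_mono_ln) (auto simp: L_def)
  qed
qed

end

section \<open>The second-highest value\<close>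

lemma beta_coeff_ge1:
  assumes "0 < lam" "lam \<le> 1" "1 \<le> n"
  shows "1 \<le> beta_coeff n lam"
proof -
  have "1 \<le> inverse (1 - lam / real k)" if "k \<in> {2..n}" for k
    using assms that by (intro one_le_inverse) (auto simp: field_simps)
  thus ?thesis
    using beta_coeff_eq_prod[of lam n] assms by (auto intro!: prod_ge_1)
qed

text \<open>At \<open>u = F x\<close>, the density with respect to \<open>M\<close> of the second-highest of \<open>n\<close> independent draws.\<close>

definition second_weight :: "nat \<Rightarrow> real \<Rightarrow> real" where
  "second_weight n u = real n * real (n - 1) * u ^ (n - 2) * (1 - u)"

lemma second_weight_measurable [measurable]: "second_weight n \<in> borel_measurable borel"
  unfolding second_weight_def by measurable

lemma second_weight_nonneg: "0 \<le> u \<Longrightarrow> u \<le> 1 \<Longrightarrow> 0 \<le> second_weight n u"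
  unfolding second_weight_def by simp

lemma second_weight_pos: "2 \<le> n \<Longrightarrow> 0 < u \<Longrightarrow> u < 1 \<Longrightarrow> 0 < second_weight n u"
  unfolding second_weight_def by simp

text \<open>The primitive is the probability that at most one of \<open>n\<close> uniform draws
  exceeds \<open>a\<close>, namely \<open>a ^ n + n * a ^ (n - 1) * (1 - a)\<close>.\<close>

lemma nn_integral_second_weight:
  assumes "2 \<le> n" "0 \<le> a" "a \<le> 1"
  shows "(\<integral>\<^sup>+u. ennreal (second_weight n u) * indicator {a<..1} u \<partial>lborel) =
    ennreal (1 - (n * a ^ (n - 1) - (n - 1) * a ^ n))"
proof -
  obtain m where m: "n = Suc (Suc m)" using assms by (metis One_nat_def Suc_1 Suc_le_D Suc_le_mono)
  let ?H = "\<lambda>u::real. n * u ^ (n - 1) - (n - 1) * u ^ n"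
  have "(\<integral>\<^sup>+u. ennreal (second_weight n u) * indicator {a<..1} u \<partial>lborel) = ennreal (?H 1 - ?H a)"
  proof (rule nn_integral_FTC_Ioc)
    show "(?H has_real_derivative second_weight n u) (at u)" for u
    proof -
      have "(?H has_real_derivative n * (real (n - 1) * u ^ (n - 1 - Suc 0)) - (n - 1) * (real n * u ^ (n - Suc 0))) (at u)"
        by (intro DERIV_diff DERIV_cmult DERIV_pow)
      also have "n * (real (n - 1) * u ^ (n - 1 - Suc 0)) - (n - 1) * (real n * u ^ (n - Suc 0)) = second_weight n u"
        by (simp add: second_weight_def m algebra_simps)
      finally show ?thesis .
    qed
  qed (use assms second_weight_nonneg in auto)
  thus ?thesis by (simp add: m)
qed

lemma nn_integral_second_weight_powr:
  assumes "2 \<le> n" "lam \<le> 1"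
  shows "(\<integral>\<^sup>+u. ennreal (second_weight n u * (1 - u) powr (-lam)) * indicator {0..1} u \<partial>lborel) =
    ennreal (beta_coeff n lam)"
proof -
  obtain m where m: "n = Suc (Suc m)" using assms by (metis One_nat_def Suc_1 Suc_le_D Suc_le_mono)
  let ?h = "\<lambda>t::real. t powr (real (Suc m) - 1) * (1 - t) powr ((2 - lam) - 1)"
  have "((\<lambda>t. n * real (n - 1) * ?h t) has_integral n * real (n - 1) * Beta (real (Suc m)) (2 - lam)) {0..1}"
    by (intro has_integral_mult_right has_integral_Beta_real) (use assms in auto)
  hence I: "(\<integral>\<^sup>+t. ennreal (n * real (n - 1) * ?h t) * indicator {0..1} t \<partial>lborel) =
     ennreal (n * real (n - 1) * Beta (real (Suc m)) (2 - lam))"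
    by (intro nn_integral_has_integral_lebesgue') auto
  have "(\<integral>\<^sup>+u. ennreal (second_weight n u * (1 - u) powr (-lam)) * indicator {0..1} u \<partial>lborel) =
      (\<integral>\<^sup>+t. ennreal (n * real (n - 1) * ?h t) * indicator {0..1} t \<partial>lborel)"
  \<comment> \<open>The endpoints are set aside because \<open>0 powr 0\<close> is 0 while
    \<open>0 ^ 0\<close> is 1, which matters for \<open>n = 2\<close>.\<close>
  proof (rule nn_integral_cong_AE, use AE_lborel_singleton[of 0] AE_lborel_singleton[of 1] in eventually_elim)
    case (elim u)
    have "second_weight n u * (1 - u) powr (-lam) = n * real (n - 1) * ?h u" if "0 < u" "u < 1"
    proof -
      have "(1 - u) powr (2 - lam - 1) = (1 - u) * (1 - u) powr (-lam)"
        using that by (simp add: powr_mult_base)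
      thus ?thesis using that by (simp add: second_weight_def m powr_realpow)
    qed
    thus ?case using elim by (cases "0 < u \<and> u < 1") (auto split: split_indicator)
  qed
  also have "\<dots> = ennreal (n * real (n - 1) * Beta (real (Suc m)) (2 - lam))" by (rule I)
  also have "n * real (n - 1) * Beta (real (Suc m)) (2 - lam) = beta_coeff n lam"
  proof -
    have "Gamma (real (Suc m)) = fact m" using Gamma_fact[of m, where 'a=real] by (simp add: add.commute)
    thus ?thesis by (simp add: Beta_def beta_coeff_def m algebra_simps)
  qed
  finally show ?thesis .
qed

locale bounded_regular_dist = regular_dist +
  fixes n :: nat and B :: real
  assumes n_ge2: "2 \<le> n" and bounded: "\<And>x. x \<in> D \<Longrightarrow> x \<le> B"
begin

definition mu :: real where "mu = (\<integral>x. x * second_weight n (F x) \<partial>M)"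

lemma weight_bound: "\<bar>second_weight n (F x)\<bar> \<le> real n * real (n - 1)"
proof -
  have "\<bar>F x ^ (n - 2) * (1 - F x)\<bar> \<le> 1"
    unfolding abs_mult using F_ge0[of x] F_le1[of x] by (intro mult_le_one) (auto simp: power_le_one)
  from mult_left_mono[OF this, of "real n * real (n - 1)"]
  show ?thesis by (simp add: second_weight_def abs_mult mult.assoc)
qed

lemma integrable_weight: "integrable M (\<lambda>x. second_weight n (F x))"
  by (rule integrable_const_bound[of _ "real n * real (n - 1)"])
    (simp_all only: real_norm_def weight_bound AE_I2, measurable)

lemma integral_weight: "(\<integral>x. second_weight n (F x) \<partial>M) = 1"
proof -
  have "(\<integral>\<^sup>+x. ennreal (second_weight n (F x)) \<partial>M) = (\<integral>\<^sup>+u. ennreal (second_weight n u) * indicator {0..1} u \<partial>lborel)"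
    by (rule nn_integral_F) measurable
  also have "\<dots> = (\<integral>\<^sup>+u. ennreal (second_weight n u) * indicator {0<..1} u \<partial>lborel)"
    by (rule nn_integral_cong_AE, rule AE_mp[OF AE_lborel_singleton[of 0]]) (auto split: split_indicator)
  also have "\<dots> = 1"
    using nn_integral_second_weight[of n 0] n_ge2 by (simp add: zero_power)
  finally have "(\<integral>\<^sup>+x. ennreal (second_weight n (F x)) \<partial>M) = 1" .
  thus ?thesis
    using F_ge0 F_le1 second_weight_nonneg by (subst integral_eq_nn_integral) auto
qed

lemma integrable_mult_bounded:
  assumes [measurable]: "g \<in> borel_measurable borel" and "\<And>x. \<bar>g x\<bar> \<le> C"
  shows "integrable M (\<lambda>x. x * g x)"
proof (rule integrable_const_bound)
  show "AE x in M. norm (x * g x) \<le> B * C"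
    using AE_D
  proof eventually_elim
    case (elim x)
    have "\<bar>x\<bar> \<le> B" using D_nonneg bounded elim by simp
    thus ?case using assms(2)[of x] by (simp add: abs_mult mult_mono)
  qed
qed measurable

lemma integrable_x_weight: "integrable M (\<lambda>x. x * second_weight n (F x))"
  by (rule integrable_mult_bounded[OF _ weight_bound]) measurable

lemma beta_integral:
  "has_bochner_integral M (\<lambda>x. second_weight n (F x) * (1 - F x) powr (-lam)) (beta_coeff n lam)"
proof (rule has_bochner_integral_nn_integral)
  show "AE x in M. 0 \<le> second_weight n (F x) * (1 - F x) powr (-lam)"
    using F_ge0 F_le1 second_weight_nonneg by auto
  show "0 \<le> beta_coeff n lam"
    using beta_coeff_ge1[of lam n] lam_pos lam_le1 n_ge2 by simp
  have "(\<integral>\<^sup>+x. ennreal (second_weight n (F x) * (1 - F x) powr (-lam)) \<partial>M) =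
     (\<integral>\<^sup>+u. ennreal (second_weight n u * (1 - u) powr (-lam)) * indicator {0..1} u \<partial>lborel)"
    by (rule nn_integral_F) measurable
  thus "(\<integral>\<^sup>+x. ennreal (second_weight n (F x) * (1 - F x) powr (-lam)) \<partial>M) = ennreal (beta_coeff n lam)"
    using nn_integral_second_weight_powr n_ge2 lam_le1 by simp
qed measurable

lemma mu_nonneg: "0 \<le> mu"
  unfolding mu_def
proof (rule integral_nonneg_AE)
  show "AE x in M. 0 \<le> x * second_weight n (F x)"
    using AE_D by eventually_elim (use F_ge0 F_le1 second_weight_nonneg D_nonneg in auto)
qed

text \<open>An average cannot exceed almost all of the values averaged. The strict inequality makes
  \<open>1 - F\<close> positive at every price \<open>c * mu\<close> with \<open>c \<le> 1\<close>,
  as the tangent line there requires.\<close>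

lemma F_mu_less1: "F mu < 1"
proof (rule ccontr)
  assume "\<not> F mu < 1"
  hence F1: "F mu = 1" using F_le1[of mu] by simp
  have pos: "AE x in M. 0 < (mu - x) * second_weight n (F x)"
    using AE_F_le_iff[of mu] AE_neq[of mu] AE_F01
    by eventually_elim (use F1 F_le1 n_ge2 second_weight_pos in auto)
  have int: "integrable M (\<lambda>x. (mu - x) * second_weight n (F x))"
    using integrable_weight integrable_x_weight by (simp add: left_diff_distrib)
  have "(\<integral>x. (mu - x) * second_weight n (F x) \<partial>M) = 0"
    using integrable_weight integrable_x_weight integral_weight by (simp add: left_diff_distrib mu_def)
  hence "AE x in M. (mu - x) * second_weight n (F x) = 0"
    by (subst (asm) integral_nonneg_eq_0_iff_AE[OF int])
      (use pos in \<open>auto elim: eventually_mono\<close>)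
  hence "AE x in M. False" using pos by eventually_elim auto
  thus False by simp
qed

text \<open>Jensen's inequality and convexity in one step: the tangent line at \<open>c mu\<close> is
  compared with the function at \<open>0\<close> and, on average, at the second highest value.\<close>

lemma one_minus_F_ge:
  assumes c: "0 \<le> c" "c \<le> 1"
  shows "(1 + c * (beta_coeff n lam - 1)) powr (- 1 / lam) \<le> 1 - F (c * mu)"
proof -
  define t where "t = c * mu"
  have b1: "1 \<le> 1 + c * (beta_coeff n lam - 1)"
    using beta_coeff_ge1[of lam n] lam_pos lam_le1 n_ge2 c by simp
  have "t \<le> mu" using c mu_nonneg by (simp add: t_def mult_left_le_one_le)
  hence Ft: "F t < 1" using F_mono[of t mu] F_mu_less1 by simp
  \<comment> \<open>If \<open>F t = 0\<close>, then \<open>t\<close> may lie below \<open>D\<close>,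
    where no tangent is at hand; but the claim is then just that a negative power of a number at
    least 1 is at most 1.\<close>
  show ?thesis
  proof (cases "F t = 0")
    case True
    have "(1 + c * (beta_coeff n lam - 1)) powr (- 1 / lam) \<le> 1 powr (- 1 / lam)"
      using b1 lam_pos by (intro powr_mono2') auto
    thus ?thesis using True by (simp add: t_def)
  next
    case False
    hence tD: "t \<in> D" using mem_D[of t] F_ge0[of t] Ft by simp
    define K where "K = (1 - F t) powr (-lam)"
    define d where "d = lam / psi t"
    have tan: "K * (1 + d * (s - t)) \<le> (1 - F s) powr (-lam)" if "F s < 1" for s
      using tangent_line[OF tD Ft that] by (simp add: K_def d_def)
    have F0: "F 0 = 0" by (rule F_eq0) (rule D_nonneg)
    have at0: "K * (1 + d * (0 - t)) \<le> 1" using tan[of 0] F0 by simp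
    have "(\<integral>x. K * (1 - d * t) * second_weight n (F x) + K * d * (x * second_weight n (F x)) \<partial>M)
        \<le> (\<integral>x. second_weight n (F x) * (1 - F x) powr (-lam) \<partial>M)"
    proof (rule integral_mono_AE)
      show "AE x in M. K * (1 - d * t) * second_weight n (F x) + K * d * (x * second_weight n (F x))
          \<le> second_weight n (F x) * (1 - F x) powr (-lam)"
        using AE_F01
      proof eventually_elim
        case (elim x)
        have "second_weight n (F x) * (K * (1 + d * (x - t))) \<le> second_weight n (F x) * (1 - F x) powr (-lam)"
          using elim by (intro mult_left_mono tan second_weight_nonneg) auto
        thus ?case by (simp add: algebra_simps)
      qed
    qed (use integrable_weight integrable_x_weight beta_integral
         in \<open>auto simp: has_bochner_integral_iff\<close>)
    hence "K * (1 - d * t) + K * d * mu \<le> beta_coeff n lam"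
      using integrable_weight integrable_x_weight integral_weight
        has_bochner_integral_integral_eq[OF beta_integral]
      by (simp add: mu_def[symmetric])
    \<comment> \<open>The tangent has value \<open>K\<close> at \<open>t = c * mu\<close>. As
      \<open>t\<close> divides the segment from 0 to \<open>mu\<close> in proportion
      \<open>c\<close>, \<open>K\<close> is the matching mixture of its values at \<open>mu\<close>,
      bounded on average by the beta coefficient, and at 0, bounded by 1.\<close>
    hence "c * (K * (1 - d * t) + K * d * mu) + (1 - c) * (K * (1 + d * (0 - t))) \<le> c * beta_coeff n lam + (1 - c) * 1"
      using c at0 by (intro add_mono mult_left_mono) auto
    moreover have "c * (K * (1 - d * t) + K * d * mu) + (1 - c) * (K * (1 + d * (0 - t))) = K"
      by (simp add: t_def algebra_simps)
    ultimately have "K \<le> c * beta_coeff n lam + (1 - c) * 1" by (simp only:)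
    hence K: "K \<le> 1 + c * (beta_coeff n lam - 1)" by (simp add: algebra_simps)
    have "0 < K" using Ft by (simp add: K_def)
    hence "(1 + c * (beta_coeff n lam - 1)) powr (- 1 / lam) \<le> K powr (- 1 / lam)"
      using K lam_pos by (intro powr_mono2') auto
    also have "\<dots> = 1 - F t" using Ft lam_pos by (simp add: K_def powr_powr)
    finally show ?thesis by (simp add: t_def)
  qed
qed

text \<open>A price such as \<open>c * mu\<close> may lie below \<open>D\<close>, where it sells
  with certainty. \<open>D\<close> need not contain its infimum, so such a price is compared with
  prices in \<open>D\<close> of small positive quantile, which are higher and sell almost
  surely.\<close>

lemma price_le:
  assumes P: "\<And>p. p \<in> D \<Longrightarrow> p * (1 - F p ^ n) \<le> P" and p: "0 \<le> p"
  shows "p * (1 - F p ^ n) \<le> P"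
proof -
  obtain q where q: "q \<in> D" using ex_quantile[of "1/2"] by auto
  have "0 \<le> q * (1 - F q ^ n)"
    using D_nonneg[OF q] F_ge0[of q] F_le1[of q] by (simp add: power_le_one)
  hence P0: "0 \<le> P" using P[OF q] by linarith
  consider "p \<in> D" | "F p = 1" | "F p = 0" "0 < p" | "p = 0"
    using mem_D[of p] F_ge0[of p] F_le1[of p] p
    by (cases "F p = 0"; cases "F p = 1"; cases "p = 0") auto
  thus ?thesis
  proof cases
    case 3
    show ?thesis
    proof (rule ccontr)
      assume "\<not> ?thesis"
      hence *: "P < p" using 3 n_ge2 by (simp add: zero_power)
      \<comment> \<open>With this choice \<open>p * (1 - e ^ n)\<close> is the midpoint of
        \<open>P\<close> and \<open>p\<close>, which exceeds \<open>P\<close>.\<close>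
      define e where "e = root n ((1 - P / p) / 2)"
      have r: "0 < (1 - P / p) / 2" "(1 - P / p) / 2 < 1" using * 3 P0 by (auto simp: field_simps)
      have e: "0 < e" "e < 1" unfolding e_def
        using r n_ge2 real_root_less_mono[of n "(1 - P / p) / 2" 1] by auto
      have en: "e ^ n = (1 - P / p) / 2" unfolding e_def using r n_ge2 by simp
      obtain t where t: "t \<in> D" "F t = e" using ex_quantile[OF e] by auto
      have "p \<le> t" using F_mono[of t p] 3 t e by (cases "p \<le> t") auto
      hence "p * (1 - F t ^ n) \<le> t * (1 - F t ^ n)"
        using F_ge0[of t] F_le1[of t] by (intro mult_right_mono) (auto simp: power_le_one)
      also have "\<dots> \<le> P" by (rule P) fact
      finally have "p * (1 - (1 - P / p) / 2) \<le> P" using t en by simp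
      thus False using * 3 by (simp add: field_simps)
    qed
  qed (use P P0 in auto)
qed

lemma g_fun_mu_le:
  assumes P: "\<And>p. p \<in> D \<Longrightarrow> p * (1 - F p ^ n) \<le> P" and c: "0 \<le> c" "c \<le> 1"
  shows "g_fun n lam c * mu \<le> P"
proof -
  define r where "r = (1 + c * (beta_coeff n lam - 1)) powr (- 1 / lam)"
  have "F (c * mu) ^ n \<le> (1 - r) ^ n"
    using one_minus_F_ge[OF c] F_ge0 by (intro power_mono) (auto simp: r_def)
  hence "c * mu * (1 - (1 - r) ^ n) \<le> c * mu * (1 - F (c * mu) ^ n)"
    using c mu_nonneg by (intro mult_left_mono) auto
  also have "\<dots> \<le> P" using price_le[OF P] c mu_nonneg by simp
  finally show ?thesis by (simp add: g_fun_def r_def mult_ac)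
qed

end

lemma g_fun_bdd: 
  assumes "0 < lam" "lam \<le> 1" "2 \<le> n"
  shows "bdd_above (g_fun n lam ` {0..1})"
proof (rule bdd_aboveI2)
  fix c :: real assume c: "c \<in> {0..1}"
  have b: "1 \<le> 1 + c * (beta_coeff n lam - 1)"
    using beta_coeff_ge1[of lam n] assms c by simp
  hence "(1 + c * (beta_coeff n lam - 1)) powr (- 1 / lam) \<le> 1 powr (- 1 / lam)"
    using assms by (intro powr_mono2') auto
  hence "c * (1 - (1 - (1 + c * (beta_coeff n lam - 1)) powr (- 1 / lam)) ^ n) \<le> 1 * 1"
    using c by (intro mult_mono) (auto simp: power_le_one)
  thus "g_fun n lam c \<le> 1" by (simp add: g_fun_def)
qed

lemma Sup_g_fun_pos:
  assumes "0 < lam" "lam \<le> 1" "2 \<le> n"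
  shows "0 < (SUP c\<in>{0..1}. g_fun n lam c)"
proof -
  have b: "1 \<le> beta_coeff n lam" using beta_coeff_ge1[of lam n] assms by simp
  define r where "r = beta_coeff n lam powr (- 1 / lam)"
  have r: "0 < r" "r \<le> 1" using b assms powr_mono2'[of "- 1 / lam" 1 "beta_coeff n lam"] by (auto simp: r_def)
  have "(1 - r) ^ n < 1" using r assms power_strict_mono[of "1 - r" 1 n] by simp
  hence "0 < g_fun n lam 1" by (simp add: g_fun_def r_def)
  also have "\<dots> \<le> (SUP c\<in>{0..1}. g_fun n lam c)"
    by (rule cSUP_upper[OF _ g_fun_bdd]) (use assms in auto)
  finally show ?thesis .
qed

lemma (in bounded_regular_dist) Sup_g_fun_mu_le:
  assumes P: "\<And>p. p \<in> D \<Longrightarrow> p * (1 - F p ^ n) \<le> P"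
  shows "mu \<le> P / (SUP c\<in>{0..1}. g_fun n lam c)"
proof -
  have S: "0 < (SUP c\<in>{0..1}. g_fun n lam c)" using Sup_g_fun_pos lam_pos lam_le1 n_ge2 by simp
  have "(SUP c\<in>{0..1}. g_fun n lam c) * mu \<le> P"
  proof (cases "mu = 0")
    case True
    thus ?thesis using g_fun_mu_le[OF P, of 0] by simp
  next
    case False
    hence m: "0 < mu" using mu_nonneg by simp
    have "(SUP c\<in>{0..1}. g_fun n lam c) \<le> P / mu"
      using g_fun_mu_le[OF P] m by (intro cSUP_least) (auto simp: field_simps)
    thus ?thesis using m by (simp add: field_simps)
  qed
  thus ?thesis using S by (simp add: field_simps)
qed

section \<open>Virtual values and the reserve price\<close>

text \<open>Cancelling the factor \<open>1 - w\<close> unifies the two cases: for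
  \<open>lam = 1\<close> the power \<open>0 powr 1\<close> is 0, so \<open>w = 1\<close> and the
  quotient is \<open>1 / n\<close>.\<close>

lemma a_coeff_eq:
  assumes "0 < lam" "lam \<le> 1" "2 \<le> n"
  defines "w \<equiv> 1 - (1 - lam) powr (1 / lam)"
  shows "a_coeff n lam = w ^ (n - 1) / (\<Sum>k<n. w ^ k)"
proof (cases "lam = 1")
  case False
  have "1 - w ^ n = (1 - w) * (\<Sum>k<n. w ^ k)" by (rule one_diff_power_eq)
  thus ?thesis using False assms by (simp add: a_coeff_def w_def)
qed (simp add: a_coeff_def w_def)

lemma a_coeff_nonneg:
  assumes "0 < lam" "lam \<le> 1" "2 \<le> n"
  shows "0 \<le> a_coeff n lam"
proof -
  have "(1 - lam) powr (1 / lam) \<le> 1" using assms by (intro powr_le1) auto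
  thus ?thesis unfolding a_coeff_eq[OF assms]
    by (intro divide_nonneg_nonneg sum_nonneg zero_le_power) auto
qed

text \<open>With \<open>v = 1 - q\<close>, the factor \<open>q\<close> cancels from
  \<open>1 - v ^ n\<close> and leaves the ratio of \<open>v ^ (n - 1)\<close> to the sum of the
  powers \<open>v ^ k\<close> with \<open>k < n\<close>. It increases with \<open>v\<close>, because
  after cross-multiplication the sums can be compared term by term.\<close>

lemma one_sale_le_a_coeff:
  assumes "0 < lam" "lam \<le> 1" "2 \<le> n" "0 \<le> q" "q \<le> 1" "1 - lam \<le> q powr lam"
  shows "q * (1 - q) ^ (n - 1) \<le> a_coeff n lam * (1 - (1 - q) ^ n)"
proof -
  define w where "w = 1 - (1 - lam) powr (1 / lam)"
  define v where "v = 1 - q"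
  have "(1 - lam) powr (1 / lam) \<le> (q powr lam) powr (1 / lam)"
    using assms by (intro powr_mono2) auto
  also have "\<dots> = q" using assms by (cases "q = 0") (auto simp: powr_powr)
  finally have vw: "v \<le> w" by (simp add: v_def w_def)
  have v0: "0 \<le> v" using assms by (simp add: v_def)
  have w0: "0 \<le> w" using v0 vw by linarith
  have S: "0 < (\<Sum>k<n. w ^ k)"
  proof -
    have "w ^ 0 \<le> (\<Sum>k<n. w ^ k)" using assms w0 by (intro member_le_sum) auto
    thus ?thesis by simp
  qed
  have "v ^ (n - 1) * (\<Sum>k<n. w ^ k) \<le> w ^ (n - 1) * (\<Sum>k<n. v ^ k)"
    unfolding sum_distrib_left
  proof (rule sum_mono)
    fix k assume "k \<in> {..<n}"
    hence "n - 1 = k + (n - 1 - k)" by simp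
    then obtain j where j: "n - 1 = k + j" by blast
    have "v ^ j * (v ^ k * w ^ k) \<le> w ^ j * (v ^ k * w ^ k)"
      using v0 w0 vw by (intro mult_right_mono power_mono) auto
    thus "v ^ (n - 1) * w ^ k \<le> w ^ (n - 1) * v ^ k"
      unfolding j power_add by (simp add: mult_ac)
  qed
  hence "v ^ (n - 1) \<le> a_coeff n lam * (\<Sum>k<n. v ^ k)"
    using S by (simp add: a_coeff_eq[OF assms(1-3)] w_def[symmetric] field_simps)
  hence "q * v ^ (n - 1) \<le> q * (a_coeff n lam * (\<Sum>k<n. v ^ k))"
    using assms by (intro mult_left_mono)
  also have "\<dots> = a_coeff n lam * (1 - v ^ n)"
    by (subst one_diff_power_eq) (simp add: v_def mult_ac)
  finally show ?thesis by (simp add: v_def)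
qed

section \<open>Virtual surplus and the second-highest value\<close>

context bounded_regular_dist
begin

definition phi :: "real \<Rightarrow> real" where "phi t = t - psi t"

lemma phi_measurable [measurable]: "phi \<in> borel_measurable borel"
  unfolding phi_def by measurable

lemma phi_mono:
  assumes "s \<in> D" "t \<in> D" "s \<le> t" shows "phi s \<le> phi t"
proof -
  have "lam * (t - s) \<le> t - s" using assms lam_le1 by (intro mult_left_le_one_le) (use lam_pos in auto)
  thus ?thesis using psi_le[OF assms] by (simp add: phi_def)
qed

text \<open>The density of \<open>M\<close> cancels the denominator of \<open>psi\<close>, so
  expectations of \<open>psi\<close> become Lebesgue integrals of tail probabilities.\<close>

lemma nn_integral_psi:
  assumes [measurable]: "k \<in> borel_measurable borel"
  shows "(\<integral>\<^sup>+x. ennreal (psi x) * k x \<partial>M) = (\<integral>\<^sup>+x. ennreal (1 - F x) * k x * indicator D x \<partial>lborel)"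
proof -
  have "(\<integral>\<^sup>+x. ennreal (psi x) * k x \<partial>M) = (\<integral>\<^sup>+x. ennreal (f x) * (ennreal (psi x) * k x) \<partial>lborel)"
    by (rule nn_integral_M) measurable
  also have "\<dots> = (\<integral>\<^sup>+x. ennreal (1 - F x) * k x * indicator D x \<partial>lborel)"
  proof (rule nn_integral_cong)
    fix x
    have "ennreal (f x) * ennreal (psi x) = ennreal (1 - F x) * indicator D x"
      using f_zero[of x] f_pos[of x] psi_nonneg[of x]
      by (cases "x \<in> D") (auto simp: ennreal_mult[symmetric] psi_def)
    thus "ennreal (f x) * (ennreal (psi x) * k x) = ennreal (1 - F x) * k x * indicator D x"
      by (metis mult.assoc mult.commute)
  qed
  finally show ?thesis .
qed

lemma integrable_psi: "integrable M psi"
proof (rule integrableI_nonneg)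
  have "(\<integral>\<^sup>+x. ennreal (psi x) \<partial>M) = (\<integral>\<^sup>+x. ennreal (1 - F x) * 1 * indicator D x \<partial>lborel)"
    using nn_integral_psi[of "\<lambda>_. 1"] by simp
  also have "\<dots> \<le> (\<integral>\<^sup>+x. indicator {0..B} x \<partial>lborel)"
    by (rule nn_integral_mono)
       (use F_ge0 F_le1 bounded D_nonneg in \<open>auto split: split_indicator\<close>)
  also have "\<dots> < \<infinity>" by (simp add: emeasure_lborel_Icc_eq)
  finally show "(\<integral>\<^sup>+x. ennreal (psi x) \<partial>M) < \<infinity>" .
qed (use psi_nonneg in auto)

lemma integrable_psi_mult:
  assumes [measurable]: "g \<in> borel_measurable borel" and "\<And>x. \<bar>g x\<bar> \<le> C"
  shows "integrable M (\<lambda>x. psi x * g x)"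
proof (rule Bochner_Integration.integrable_bound)
  show "integrable M (\<lambda>x. C * psi x)" using integrable_psi by simp
  show "AE x in M. norm (psi x * g x) \<le> norm (C * psi x)"
  proof (rule AE_I2)
    fix x
    have "\<bar>g x\<bar> * psi x \<le> C * psi x" by (intro mult_right_mono assms psi_nonneg)
    also have "\<dots> \<le> \<bar>C * psi x\<bar>" by simp
    finally show "norm (psi x * g x) \<le> norm (C * psi x)"
      using psi_nonneg[of x] by (simp add: abs_mult mult.commute)
  qed
qed measurable

lemma max_weight_bound: "\<bar>real n * F x ^ (n - 1)\<bar> \<le> real n"
  using F_ge0[of x] F_le1[of x] by (simp add: abs_mult power_le_one mult_left_le)

text \<open>Revenue equivalence for the second-price auction without reserve, obtained by comparing
  tails. The highest draw exceeds \<open>s\<close> with probability \<open>1 - F s ^ n\<close>, and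
  the second-highest with a probability smaller by \<open>n * F s ^ (n - 1) * (1 - F s)\<close>, the
  chance that exactly one draw does. Integrated over \<open>s\<close>, this gap is the expectation
  of \<open>psi\<close> weighted by \<open>n * F ^ (n - 1)\<close>.\<close>

lemma mu_eq: "(\<integral>x. phi x * (real n * F x ^ (n - 1)) \<partial>M) = mu"
proof -
  obtain m where m: "n = Suc (Suc m)" using n_ge2 by (metis One_nat_def Suc_1 Suc_le_D Suc_le_mono)
  define k where "k u = real n * u ^ (n - 1)" for u :: real
  have [measurable]: "k \<in> borel_measurable borel" unfolding k_def by measurable
  have kF: "0 \<le> k (F x)" for x using F_ge0 by (simp add: k_def)
  have ix: "integrable M (\<lambda>x. x * k (F x))"
    by (rule integrable_mult_bounded[of _ "real n"]) (simp_all only: k_def max_weight_bound, measurable)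
  have ip: "integrable M (\<lambda>x. psi x * k (F x))"
    by (rule integrable_psi_mult[of _ "real n"]) (simp_all only: k_def max_weight_bound, measurable)
  have "ennreal (\<integral>x. x * k (F x) \<partial>M) = (\<integral>\<^sup>+x. ennreal (x * k (F x)) \<partial>M)"
    by (rule nn_integral_eq_integral[symmetric, OF ix], use AE_D in eventually_elim)
       (simp add: kF D_nonneg)
  also have "\<dots> = (\<integral>\<^sup>+x. ennreal x * ennreal (k (F x)) \<partial>M)"
    by (rule nn_integral_cong_AE, use AE_D in eventually_elim) (simp add: ennreal_mult D_nonneg kF)
  also have "\<dots> = (\<integral>\<^sup>+s. (\<integral>\<^sup>+u. ennreal (k u) * indicator {F s<..1} u \<partial>lborel) * indicator {0..} s \<partial>lborel)"
    by (rule nn_integral_layer) measurable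
  also have "\<dots> = (\<integral>\<^sup>+s. ennreal (1 - F s ^ n) * indicator {0..} s \<partial>lborel)"
  proof (rule nn_integral_cong)
    fix s
    have "(\<integral>\<^sup>+u. ennreal (k u) * indicator {F s<..1} u \<partial>lborel) = ennreal (1 ^ n - F s ^ n)"
    proof (rule nn_integral_FTC_Ioc)
      show "((\<lambda>u. u ^ n) has_real_derivative k u) (at u)" for u
        unfolding k_def using DERIV_pow[of n u] by simp
      show "0 \<le> k u" if "F s \<le> u" for u
        unfolding k_def using that F_ge0[of s] by simp
    qed (use F_le1 in auto)
    thus "(\<integral>\<^sup>+u. ennreal (k u) * indicator {F s<..1} u \<partial>lborel) * indicator {0..} s =
       ennreal (1 - F s ^ n) * indicator {0..} s" by simp
  qed
  also have "\<dots> = (\<integral>\<^sup>+s. ennreal (1 - (real n * F s ^ (n - 1) - real (n - 1) * F s ^ n)) * indicator {0..} s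
        + ennreal (1 - F s) * ennreal (k (F s)) * indicator D s \<partial>lborel)"
  proof (rule nn_integral_cong)
    fix s
    have e: "1 - F s ^ n = (1 - (real n * F s ^ (n - 1) - real (n - 1) * F s ^ n)) + (1 - F s) * k (F s)"
      by (simp add: m k_def algebra_simps)
    have nn: "0 \<le> 1 - (real n * F s ^ (n - 1) - real (n - 1) * F s ^ n)"
    proof -
      have "1 - F s ^ n = (1 - F s) * (\<Sum>i<n. F s ^ i)" by (rule one_diff_power_eq)
      moreover have "real n * F s ^ (n - 1) \<le> (\<Sum>i<n. F s ^ i)"
      proof -
        have "(\<Sum>i<n. F s ^ (n - 1)) \<le> (\<Sum>i<n. F s ^ i)"
          using F_ge0[of s] F_le1[of s] by (intro sum_mono power_decreasing) auto
        thus ?thesis by simp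
      qed
      ultimately have "(1 - F s) * k (F s) \<le> 1 - F s ^ n"
        using F_le1[of s] by (simp add: k_def mult_left_mono)
      thus ?thesis using e by linarith
    qed
    have "ennreal (1 - F s ^ n) = ennreal (1 - (real n * F s ^ (n - 1) - real (n - 1) * F s ^ n)) + ennreal ((1 - F s) * k (F s))"
      unfolding e by (rule ennreal_plus) (use nn kF F_le1[of s] in auto)
    also have "ennreal ((1 - F s) * k (F s)) = ennreal (1 - F s) * ennreal (k (F s))"
      by (rule ennreal_mult) (use kF F_le1[of s] in auto)
    finally have *: "ennreal (1 - F s ^ n) = ennreal (1 - (real n * F s ^ (n - 1) - real (n - 1) * F s ^ n)) + ennreal (1 - F s) * ennreal (k (F s))" .
    \<comment> \<open>Off \<open>D\<close> the cdf is 0 or 1, and the gap between the two tails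
      vanishes in either case; at 0 this uses \<open>n \<ge> 2\<close>.\<close>
    have "ennreal (1 - F s) * ennreal (k (F s)) = 0" if "s \<notin> D"
      using mem_D[of s] that F_ge0[of s] F_le1[of s] by (auto simp: k_def m)
    thus "ennreal (1 - F s ^ n) * indicator {0..} s = ennreal (1 - (real n * F s ^ (n - 1) - real (n - 1) * F s ^ n)) * indicator {0..} s
        + ennreal (1 - F s) * ennreal (k (F s)) * indicator D s"
      using * D_nonneg[of s] by (cases "s \<in> D"; cases "0 \<le> s") auto
  qed
  also have "\<dots> = (\<integral>\<^sup>+s. ennreal (1 - (real n * F s ^ (n - 1) - real (n - 1) * F s ^ n)) * indicator {0..} s \<partial>lborel)
      + (\<integral>\<^sup>+s. ennreal (1 - F s) * ennreal (k (F s)) * indicator D s \<partial>lborel)"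
    by (rule nn_integral_add) measurable
  also have "(\<integral>\<^sup>+s. ennreal (1 - F s) * ennreal (k (F s)) * indicator D s \<partial>lborel) =
      (\<integral>\<^sup>+x. ennreal (psi x) * ennreal (k (F x)) \<partial>M)"
    by (rule nn_integral_psi[symmetric]) measurable
  also have "\<dots> = (\<integral>\<^sup>+x. ennreal (psi x * k (F x)) \<partial>M)"
    by (rule nn_integral_cong) (simp add: ennreal_mult psi_nonneg kF)
  also have "\<dots> = ennreal (\<integral>x. psi x * k (F x) \<partial>M)"
    by (rule nn_integral_eq_integral[OF ip]) (simp add: psi_nonneg kF)
  also have "(\<integral>\<^sup>+s. ennreal (1 - (real n * F s ^ (n - 1) - real (n - 1) * F s ^ n)) * indicator {0..} s \<partial>lborel)
     = (\<integral>\<^sup>+s. (\<integral>\<^sup>+u. ennreal (second_weight n u) * indicator {F s<..1} u \<partial>lborel) * indicator {0..} s \<partial>lborel)"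
    by (rule nn_integral_cong) (subst nn_integral_second_weight, use n_ge2 F_ge0 F_le1 in auto)
  also have "\<dots> = (\<integral>\<^sup>+x. ennreal x * ennreal (second_weight n (F x)) \<partial>M)"
    by (rule nn_integral_layer[symmetric]) measurable
  also have "\<dots> = (\<integral>\<^sup>+x. ennreal (x * second_weight n (F x)) \<partial>M)"
    by (rule nn_integral_cong_AE, use AE_D in eventually_elim)
       (simp add: ennreal_mult D_nonneg second_weight_nonneg F_ge0 F_le1)
  also have "\<dots> = ennreal mu" unfolding mu_def
    by (rule nn_integral_eq_integral[OF integrable_x_weight], use AE_D in eventually_elim)
       (simp add: D_nonneg second_weight_nonneg F_ge0 F_le1)
  also have "ennreal mu + ennreal (\<integral>x. psi x * k (F x) \<partial>M) = ennreal (mu + (\<integral>x. psi x * k (F x) \<partial>M))"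
    by (rule ennreal_plus[symmetric]) (auto simp: mu_nonneg psi_nonneg kF intro!: integral_nonneg_AE)
  finally have "(\<integral>x. x * k (F x) \<partial>M) = mu + (\<integral>x. psi x * k (F x) \<partial>M)"
  proof (subst (asm) ennreal_inj)
    show "0 \<le> (\<integral>x. x * k (F x) \<partial>M)"
      by (rule integral_nonneg_AE, use AE_D in eventually_elim) (simp add: kF D_nonneg)
    show "0 \<le> mu + (\<integral>x. psi x * k (F x) \<partial>M)"
      by (auto simp: mu_nonneg psi_nonneg kF intro!: integral_nonneg_AE add_nonneg_nonneg)
  qed
  hence "(\<integral>x. phi x * k (F x) \<partial>M) = mu"
    using ix ip by (simp add: phi_def left_diff_distrib)
  thus ?thesis by (simp add: k_def)
qed

section \<open>Negative virtual values below the reserve\<close>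

definition phi_neg :: "real \<Rightarrow> real" where "phi_neg t = max 0 (- phi t)"

lemma phi_neg_measurable [measurable]: "phi_neg \<in> borel_measurable borel"
  unfolding phi_neg_def by measurable

lemma phi_neg_nonneg: "0 \<le> phi_neg t" by (simp add: phi_neg_def)

lemma phi_neg_antimono: "s \<in> D \<Longrightarrow> t \<in> D \<Longrightarrow> s \<le> t \<Longrightarrow> phi_neg t \<le> phi_neg s"
  using phi_mono[of s t] by (simp add: phi_neg_def)

lemma phi_neg_le_psi: "x \<in> D \<Longrightarrow> phi_neg x \<le> psi x"
  using D_nonneg[of x] psi_nonneg[of x] by (auto simp: phi_neg_def phi_def)

lemma integrable_phi_neg_mult:
  assumes [measurable]: "g \<in> borel_measurable borel" and "\<And>x. \<bar>g x\<bar> \<le> C"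
  shows "integrable M (\<lambda>x. phi_neg x * g x)"
proof (rule Bochner_Integration.integrable_bound)
  show "integrable M (\<lambda>x. psi x * C)" using integrable_psi by simp
  show "AE x in M. norm (phi_neg x * g x) \<le> norm (psi x * C)"
    using AE_D
  proof eventually_elim
    case (elim x)
    have "phi_neg x * \<bar>g x\<bar> \<le> psi x * C"
      by (intro mult_mono assms phi_neg_le_psi elim psi_nonneg) auto
    also have "\<dots> \<le> \<bar>psi x * C\<bar>" by simp
    finally show ?case using phi_neg_nonneg[of x] by (simp add: abs_mult)
  qed
qed measurable

text \<open>By parts, the difference of the two integrals is \<open>p (1 - F p)\<close> minus the infimum of \<open>D\<close>
  when \<open>p\<close> lies in \<open>D\<close>.\<close>

lemma integral_psi_below_le:
  assumes p: "0 \<le> p"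
  shows "(\<integral>x. psi x * indicator {..p} x \<partial>M) \<le> p * (1 - F p) + (\<integral>x. x * indicator {..p} x \<partial>M)"
proof -
  have ix: "integrable M (\<lambda>x. x * indicator {..p} x)"
    by (rule integrable_mult_bounded[of _ 1]) (auto split: split_indicator)
  have ip: "integrable M (\<lambda>x. psi x * indicator {..p} x)"
    by (rule integrable_psi_mult[of _ 1]) (auto split: split_indicator)
  have "ennreal (\<integral>x. psi x * indicator {..p} x \<partial>M) = (\<integral>\<^sup>+x. ennreal (psi x) * indicator {..p} x \<partial>M)"
    by (subst nn_integral_eq_integral[symmetric, OF ip])
       (auto simp: psi_nonneg intro!: nn_integral_cong split: split_indicator)
  also have "\<dots> = (\<integral>\<^sup>+x. ennreal (1 - F x) * indicator {..p} x * indicator D x \<partial>lborel)"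
    by (rule nn_integral_psi) measurable
  \<comment> \<open>The area under the tail up to \<open>p\<close> splits into a rectangle of height
    \<open>1 - F p\<close> and the area between \<open>F\<close> and the level \<open>F p\<close>.
    The latter is the mean over values up to \<open>p\<close>, read in layers.\<close>
  also have "\<dots> \<le> (\<integral>\<^sup>+x. ennreal (1 - F p) * indicator {0..p} x + ennreal (F p - F x) * indicator {0..p} x \<partial>lborel)"
  proof (rule nn_integral_mono)
    fix x
    have "ennreal (1 - F x) = ennreal (1 - F p) + ennreal (F p - F x)" if "x \<le> p"
      using F_mono[OF that] F_le1[of p] by (subst ennreal_plus[symmetric]) auto
    thus "ennreal (1 - F x) * indicator {..p} x * indicator D x \<le>
        ennreal (1 - F p) * indicator {0..p} x + ennreal (F p - F x) * indicator {0..p} x"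
      using D_nonneg[of x] by (auto split: split_indicator)
  qed
  also have "\<dots> = (\<integral>\<^sup>+x. ennreal (1 - F p) * indicator {0..p} x \<partial>lborel) + (\<integral>\<^sup>+x. ennreal (F p - F x) * indicator {0..p} x \<partial>lborel)"
    by (rule nn_integral_add) measurable
  also have "(\<integral>\<^sup>+x. ennreal (1 - F p) * indicator {0..p} x \<partial>lborel) = ennreal (p * (1 - F p))"
    using p F_le1[of p] by (subst nn_integral_cmult_indicator) (auto simp: ennreal_mult[symmetric] mult.commute)
  also have "(\<integral>\<^sup>+x. ennreal (F p - F x) * indicator {0..p} x \<partial>lborel) \<le> ennreal (\<integral>x. x * indicator {..p} x \<partial>M)"
  proof -
    have "(\<integral>\<^sup>+x. ennreal (F p - F x) * indicator {0..p} x \<partial>lborel) \<le>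
      (\<integral>\<^sup>+s. (\<integral>\<^sup>+u. indicator {..F p} u * indicator {F s<..1} u \<partial>lborel) * indicator {0..} s \<partial>lborel)"
    proof (rule nn_integral_mono)
      fix s
      have "(\<integral>\<^sup>+u. indicator {..F p} u * indicator {F s<..1} u \<partial>lborel) = (\<integral>\<^sup>+u. indicator {F s<..F p} u \<partial>lborel)"
        using F_le1[of p] by (intro nn_integral_cong) (auto split: split_indicator)
      also have "\<dots> = emeasure lborel {F s<..F p}" by simp
      finally have "(\<integral>\<^sup>+u. indicator {..F p} u * indicator {F s<..1} u \<partial>lborel) = emeasure lborel {F s<..F p}" .
      thus "ennreal (F p - F s) * indicator {0..p} s \<le>
         (\<integral>\<^sup>+u. indicator {..F p} u * indicator {F s<..1} u \<partial>lborel) * indicator {0..} s"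
        using F_mono[of s p] by (auto split: split_indicator)
    qed
    also have "\<dots> = (\<integral>\<^sup>+x. ennreal x * indicator {..F p} (F x) \<partial>M)"
      by (rule nn_integral_layer[symmetric]) measurable
    also have "\<dots> = (\<integral>\<^sup>+x. ennreal (x * indicator {..p} x) \<partial>M)"
      by (rule nn_integral_cong_AE, use AE_F_le_iff[of p] in eventually_elim) (auto split: split_indicator)
    also have "\<dots> = ennreal (\<integral>x. x * indicator {..p} x \<partial>M)"
      by (rule nn_integral_eq_integral[OF ix], use AE_D in eventually_elim) (auto simp: D_nonneg)
    finally show ?thesis .
  qed
  finally have "ennreal (\<integral>x. psi x * indicator {..p} x \<partial>M) \<le>
      ennreal (p * (1 - F p)) + ennreal (\<integral>x. x * indicator {..p} x \<partial>M)"
    by (simp add: add_left_mono)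
  moreover have nn: "0 \<le> (\<integral>x. x * indicator {..p} x \<partial>M)"
    by (rule integral_nonneg_AE, use AE_D in eventually_elim) (auto simp: D_nonneg)
  ultimately show ?thesis
    using p F_le1[of p] by (simp add: ennreal_plus[symmetric] del: ennreal_plus)
qed

text \<open>A negative virtual value means \<open>t < psi t\<close>, so the tangent at
  \<open>t\<close>, followed back to 0, still has height at least \<open>1 - lam\<close> times its
  value at \<open>t\<close>. The convex function it supports equals 1 at 0.\<close>

lemma reserve_quantile:
  assumes t: "t \<in> D" "phi t < 0"
  shows "1 - lam \<le> (1 - F t) powr lam"
proof -
  have psi: "t < psi t" "0 < psi t" using t D_nonneg[of t] by (auto simp: phi_def)
  have Ft: "F t < 1" using psi f_pos[OF t(1)] F_le1[of t] by (cases "F t = 1") (auto simp: psi_def)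
  have F0: "F 0 = 0" by (rule F_eq0) (rule D_nonneg)
  define K where "K = (1 - F t) powr (-lam)"
  have "K * (1 + lam * (0 - t) / psi t) \<le> 1"
    using tangent_line[OF t(1) Ft, of 0] F0 by (simp add: K_def)
  moreover have "1 - lam \<le> 1 + lam * (0 - t) / psi t"
    using psi lam_pos by (simp add: field_simps)
  moreover have "0 < K" using Ft by (simp add: K_def)
  ultimately have "K * (1 - lam) \<le> 1" by (meson mult_left_mono less_imp_le order_trans)
  moreover have "K * (1 - F t) powr lam = 1" using Ft by (simp add: K_def powr_minus)
  ultimately have "K * (1 - lam) \<le> K * (1 - F t) powr lam" by simp
  thus ?thesis using \<open>0 < K\<close> by simp
qed

lemma phi_neg_integral_le:
  "\<exists>p\<ge>0. (\<integral>x. phi_neg x * (real n * F x ^ (n - 1)) \<partial>M) \<le> p * ((1 - F p) * F p ^ (n - 1))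
     \<and> 1 - lam \<le> (1 - F p) powr lam"
proof -
  define A where "A = {t\<in>D. phi t < 0}"
  have zero: "(\<integral>x. phi_neg x * (real n * F x ^ (n - 1)) \<partial>M) = 0" if "AE x in M. x \<notin> A"
  proof (rule integral_eq_zero_AE)
    show "AE x in M. phi_neg x * (real n * F x ^ (n - 1)) = 0"
      using that AE_D by eventually_elim (auto simp: A_def phi_neg_def)
  qed
  show ?thesis
  proof (cases "A = {}")
    case True
    have F0: "F 0 = 0" by (rule F_eq0) (rule D_nonneg)
    show ?thesis by (rule exI[of _ 0]) (use True zero F0 lam_pos in auto)
  next
    case False
    \<comment> \<open>The virtual value may jump, so it need not vanish anywhere. With the supremum
      it is negative on \<open>D\<close> below \<open>p\<close> and nonnegative above, and the point
      \<open>p\<close> itself has measure zero.\<close>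
    define p where "p = Sup A"
    have bdd: "bdd_above A" by (rule bdd_aboveI[of _ B]) (simp add: A_def bounded)
    have below: "x \<le> p" if "x \<in> A" for x unfolding p_def by (rule cSup_upper[OF that bdd])
    have above: "phi x < 0" if xD: "x \<in> D" and xp: "x < p" for x
    proof -
      obtain a where "a \<in> A" "x < a" using less_cSupD[OF False, of x] xp unfolding p_def by blast
      thus ?thesis using phi_mono[of x a] xD by (auto simp: A_def)
    qed
    have at_above: "phi_neg x = 0" if "x \<in> D" "p < x" for x
    proof -
      have "0 \<le> phi x" using below[of x] that by (force simp: A_def)
      thus ?thesis by (simp add: phi_neg_def)
    qed
    have at_below: "phi_neg x = psi x - x" if "x \<in> D" "x < p" for x
      using above[OF that] by (simp add: phi_neg_def phi_def)
    have p0: "0 \<le> p" using False below D_nonneg by (auto simp: A_def intro: order_trans)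
    \<comment> \<open>The quantile bound is known on \<open>A\<close>, which need not contain
      \<open>p\<close>; by continuity of \<open>F\<close> it passes to the supremum.\<close>
    have cl: "closed {t. 1 - lam \<le> (1 - F t) powr lam}"
    proof (rule closed_Collect_le)
      show "continuous_on UNIV (\<lambda>t. (1 - F t) powr lam)"
        using F_le1 lam_pos isCont_F
        by (intro continuous_on_powr' continuous_intros) (auto simp: continuous_on_eq_continuous_at)
    qed auto
    have q: "1 - lam \<le> (1 - F p) powr lam"
      using closed_subset_contains_Sup[OF cl _ False bdd] reserve_quantile
      by (auto simp: A_def p_def)
    have "(\<integral>x. phi_neg x * (real n * F x ^ (n - 1)) \<partial>M) \<le> p * ((1 - F p) * F p ^ (n - 1))"
    proof (cases "F p = 0")
      case True
      have "AE x in M. x \<notin> A"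
        using AE_F01 by eventually_elim (use True below F_mono[of _ p] in force)
      thus ?thesis using zero True n_ge2 p0 by simp
    next
      case False
      hence Fp: "0 < F p" using F_ge0[of p] by simp
      \<comment> \<open>The constant places \<open>t0\<close> where the weight
        \<open>n * F ^ (n - 1)\<close> crosses its mean \<open>F p ^ (n - 1)\<close> over the values
        up to \<open>p\<close>.\<close>
      define r where "r = root (n - 1) (1 / real n)"
      have r: "0 < r" "r < 1" and rn: "r ^ (n - 1) = 1 / real n"
        unfolding r_def using n_ge2 real_root_less_mono[of "n - 1" "1 / real n" 1] by auto
      have "0 < F p * r" "F p * r < F p" using r Fp by auto
      moreover from this have "F p * r < 1" using F_le1[of p] by linarith
      ultimately obtain t0 where t0: "t0 \<in> D" "F t0 = F p * r" using ex_quantile by blast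
      have t0p: "t0 < p" using F_mono[of p t0] t0 r Fp by (cases "t0 < p") auto
      have nt0: "real n * F t0 ^ (n - 1) = F p ^ (n - 1)"
        unfolding t0(2) power_mult_distrib rn using n_ge2 by simp
      \<comment> \<open>The deviation of the weight from its mean: negative or zero before
        \<open>t0\<close>, nonnegative after it, and of integral 0 over the values up to
        \<open>p\<close>.\<close>
      define h where "h x = real n * F x ^ (n - 1) - F p ^ (n - 1)" for x
      have [measurable]: "h \<in> borel_measurable borel" unfolding h_def by measurable
      have h_bound: "\<bar>h x\<bar> \<le> real n + 1" for x
      proof -
        have "\<bar>h x\<bar> \<le> \<bar>real n * F x ^ (n - 1)\<bar> + \<bar>F p ^ (n - 1)\<bar>" unfolding h_def by (rule abs_triangle_ineq4)
        also have "\<bar>F p ^ (n - 1)\<bar> \<le> 1" using F_ge0[of p] F_le1[of p] by (simp add: power_le_one)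
        finally show ?thesis using max_weight_bound[of x] by linarith
      qed
      have int_h: "integrable M (\<lambda>x. h x * indicator {..p} x)"
        by (rule integrable_const_bound[of _ "real n + 1"]) (use h_bound in \<open>auto split: split_indicator intro!: AE_I2\<close>)
      \<comment> \<open>Chebyshev's inequality by a single crossing: \<open>phi_neg\<close>
        decreases, so replacing it by its value at \<open>t0\<close> raises the product both where
        \<open>h\<close> is negative and where it is positive.\<close>
      have "(\<integral>x. phi_neg x * h x \<partial>M) \<le> (\<integral>x. phi_neg t0 * (h x * indicator {..p} x) \<partial>M)"
      proof (rule integral_mono_AE)
        show "AE x in M. phi_neg x * h x \<le> phi_neg t0 * (h x * indicator {..p} x)"
          using AE_D
        proof eventually_elim
          case (elim x)
          consider "p < x" | "x \<le> p" "t0 \<le> x" | "x \<le> p" "x < t0" by linarith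
          thus ?case
          proof cases
            case 1
            hence "phi_neg x = 0" using at_above elim by simp
            thus ?thesis using 1 by simp
          next
            case 2
            have "F t0 ^ (n - 1) \<le> F x ^ (n - 1)" using 2 F_ge0 F_mono by (intro power_mono) auto
            hence "0 \<le> h x" using mult_left_mono[of "F t0 ^ (n - 1)" "F x ^ (n - 1)" "real n"] nt0 by (simp add: h_def)
            thus ?thesis using 2 phi_neg_antimono[OF t0(1) elim] by (simp add: mult_right_mono)
          next
            case 3
            have "F x ^ (n - 1) \<le> F t0 ^ (n - 1)" using 3 F_ge0 F_mono by (intro power_mono) auto
            hence "h x \<le> 0" using mult_left_mono[of "F x ^ (n - 1)" "F t0 ^ (n - 1)" "real n"] nt0 by (simp add: h_def)
            thus ?thesis using 3 phi_neg_antimono[OF elim t0(1)] by (simp add: mult_right_mono_neg)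
          qed
        qed
        show "integrable M (\<lambda>x. phi_neg x * h x)"
          by (rule integrable_phi_neg_mult[OF _ h_bound]) measurable
        show "integrable M (\<lambda>x. phi_neg t0 * (h x * indicator {..p} x))" using int_h by simp
      qed
      also have "\<dots> = phi_neg t0 * (\<integral>x. h x * indicator {..p} x \<partial>M)" by simp
      \<comment> \<open>The bound -1 below stands for minus infinity: values are nonnegative, so
        \<open>F (-1) = 0\<close>.\<close>
      also have "(\<integral>x. h x * indicator {..p} x \<partial>M) = 0"
      proof -
        have i1: "integrable M (\<lambda>x. real n * F x ^ (n - 1) * indicator {..p} x)"
          by (rule integrable_const_bound[of _ "real n"])
             (use max_weight_bound in \<open>auto split: split_indicator intro!: AE_I2\<close>)
        have "(\<integral>\<^sup>+x. ennreal (real n * F x ^ (n - 1) * indicator {..p} x) \<partial>M) =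
              (\<integral>\<^sup>+x. ennreal (real n * F x ^ (n - 1)) * indicator {-1<..p} x \<partial>M)"
          by (rule nn_integral_cong_AE, use AE_D in eventually_elim)
             (use D_nonneg in \<open>force split: split_indicator\<close>)
        also have "\<dots> = (\<integral>\<^sup>+u. ennreal (real n * u ^ (n - 1)) * indicator {F (-1)<..F p} u \<partial>lborel)"
          by (rule nn_integral_Ioc_F) measurable
        also have "\<dots> = ennreal (F p ^ n - F (-1) ^ n)"
          by (rule nn_integral_FTC_Ioc)
             (use F_mono p0 F_ge0[of "-1"] DERIV_pow[of n] in auto)
        also have "F (-1) = 0" by (rule F_eq0) (use D_nonneg in force)
        finally have e1: "(\<integral>x. real n * F x ^ (n - 1) * indicator {..p} x \<partial>M) = F p ^ n"
          using F_ge0 n_ge2 by (subst integral_eq_nn_integral) (auto simp: zero_power)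
        have i2: "integrable M (\<lambda>x. F p ^ (n - 1) * indicator {..p} x)"
          by (intro integrable_mult_right integrable_real_indicator) (auto simp: emeasure_eq_measure)
        have "F p ^ (n - 1) * F p = F p ^ n"
          using n_ge2 by (simp flip: power_Suc2)
        hence e2: "(\<integral>x. F p ^ (n - 1) * indicator {..p} x \<partial>M) = F p ^ n"
          by (simp add: cdf_def2)
        have "(\<integral>x. h x * indicator {..p} x \<partial>M) =
            (\<integral>x. real n * F x ^ (n - 1) * indicator {..p} x - F p ^ (n - 1) * indicator {..p} x \<partial>M)"
          by (simp only: h_def left_diff_distrib)
        also have "\<dots> = 0"
          by (subst Bochner_Integration.integral_diff[OF i1 i2]) (simp only: e1 e2 diff_self)
        finally show ?thesis .
      qed
      finally have cheb: "(\<integral>x. phi_neg x * h x \<partial>M) \<le> 0" by simp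
      have in1: "integrable M (\<lambda>x. phi_neg x * (real n * F x ^ (n - 1)))"
        by (rule integrable_phi_neg_mult[OF _ max_weight_bound]) measurable
      have in2: "integrable M phi_neg" using integrable_phi_neg_mult[of "\<lambda>_. 1" 1] by simp
      have "(\<integral>x. phi_neg x * (real n * F x ^ (n - 1)) \<partial>M) - F p ^ (n - 1) * (\<integral>x. phi_neg x \<partial>M) = (\<integral>x. phi_neg x * h x \<partial>M)"
        using in1 in2 by (simp add: h_def right_diff_distrib mult.commute[of "F p ^ (n - 1)"])
      hence le: "(\<integral>x. phi_neg x * (real n * F x ^ (n - 1)) \<partial>M) \<le> F p ^ (n - 1) * (\<integral>x. phi_neg x \<partial>M)"
        using cheb by linarith
      have ix: "integrable M (\<lambda>x. x * indicator {..p} x)"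
        by (rule integrable_mult_bounded[of _ 1]) (auto split: split_indicator)
      have ip: "integrable M (\<lambda>x. psi x * indicator {..p} x)"
        by (rule integrable_psi_mult[of _ 1]) (auto split: split_indicator)
      have "(\<integral>x. phi_neg x \<partial>M) = (\<integral>x. psi x * indicator {..p} x - x * indicator {..p} x \<partial>M)"
      proof (rule integral_cong_AE)
        show "AE x in M. phi_neg x = psi x * indicator {..p} x - x * indicator {..p} x"
          using AE_D AE_neq[of p]
        proof eventually_elim
          case (elim x)
          thus ?case using at_above[of x] at_below[of x] by (cases "x < p") auto
        qed
      qed measurable
      also have "\<dots> \<le> p * (1 - F p)"
        using integral_psi_below_le[OF p0] ix ip by simp
      finally have "F p ^ (n - 1) * (\<integral>x. phi_neg x \<partial>M) \<le> F p ^ (n - 1) * (p * (1 - F p))"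
        using F_ge0 by (intro mult_left_mono) auto
      thus ?thesis using le by (simp add: mult_ac)
    qed
    thus ?thesis using p0 q by blast
  qed
qed

lemma virtual_surplus_le:
  assumes P: "\<And>p. p \<in> D \<Longrightarrow> p * (1 - F p ^ n) \<le> P"
  shows "(\<integral>x. max 0 (phi x) * (real n * F x ^ (n - 1)) \<partial>M)
    \<le> (1 / (SUP c\<in>{0..1}. g_fun n lam c) + a_coeff n lam) * P"
proof -
  obtain p where p: "0 \<le> p"
    "(\<integral>x. phi_neg x * (real n * F x ^ (n - 1)) \<partial>M) \<le> p * ((1 - F p) * F p ^ (n - 1))"
    "1 - lam \<le> (1 - F p) powr lam" using phi_neg_integral_le by blast
  have in1: "integrable M (\<lambda>x. phi_neg x * (real n * F x ^ (n - 1)))"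
    by (rule integrable_phi_neg_mult[OF _ max_weight_bound]) measurable
  have "integrable M (\<lambda>x. x * (real n * F x ^ (n - 1)) - psi x * (real n * F x ^ (n - 1)))"
    by (intro Bochner_Integration.integrable_diff integrable_mult_bounded[OF _ max_weight_bound]
        integrable_psi_mult[OF _ max_weight_bound]) measurable
  hence in2: "integrable M (\<lambda>x. phi x * (real n * F x ^ (n - 1)))"
    by (simp add: phi_def left_diff_distrib)
  have "(\<integral>x. max 0 (phi x) * (real n * F x ^ (n - 1)) \<partial>M) =
      (\<integral>x. phi x * (real n * F x ^ (n - 1)) + phi_neg x * (real n * F x ^ (n - 1)) \<partial>M)"
    by (rule Bochner_Integration.integral_cong) (auto simp: phi_neg_def max_def)
  also have "\<dots> = mu + (\<integral>x. phi_neg x * (real n * F x ^ (n - 1)) \<partial>M)"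
    using in1 in2 mu_eq by simp
  also have "\<dots> \<le> P / (SUP c\<in>{0..1}. g_fun n lam c) + a_coeff n lam * P"
  proof (rule add_mono)
    show "mu \<le> P / (SUP c\<in>{0..1}. g_fun n lam c)" by (rule Sup_g_fun_mu_le[OF P])
    have "(1 - F p) * F p ^ (n - 1) \<le> a_coeff n lam * (1 - F p ^ n)"
      using one_sale_le_a_coeff[of lam n "1 - F p"] lam_pos lam_le1 n_ge2 F_ge0[of p] F_le1[of p] p by simp
    hence "p * ((1 - F p) * F p ^ (n - 1)) \<le> a_coeff n lam * (p * (1 - F p ^ n))"
      using mult_left_mono[OF _ p(1)] by (metis mult.left_commute)
    also have "\<dots> \<le> a_coeff n lam * P"
      using a_coeff_nonneg[OF lam_pos lam_le1 n_ge2] price_le[OF P p(1)] by (intro mult_left_mono)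
    finally show "(\<integral>x. phi_neg x * (real n * F x ^ (n - 1)) \<partial>M) \<le> a_coeff n lam * P"
      using p(2) by linarith
  qed
  finally show ?thesis by (simp add: distrib_right)
qed

end

section \<open>Truthful mechanisms for one buyer\<close>

text \<open>The subgradient inequality sums to a lower Riemann sum shifted by one step.\<close>

lemma nn_integral_subgradient_le:
  fixes x u :: "real \<Rightarrow> real"
  assumes [measurable]: "x \<in> borel_measurable borel" and "a \<le> y"
    and sub: "\<And>s t. a \<le> s \<Longrightarrow> s \<le> t \<Longrightarrow> t \<le> y \<Longrightarrow> (t - s) * x s \<le> u t - u s"
    and mono: "\<And>s t. a \<le> s \<Longrightarrow> s \<le> t \<Longrightarrow> t \<le> y \<Longrightarrow> x s \<le> x t"
    and x01: "\<And>s. a \<le> s \<Longrightarrow> s \<le> y \<Longrightarrow> 0 \<le> x s \<and> x s \<le> 1"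
  shows "(\<integral>\<^sup>+t. ennreal (x t) * indicator {a<..y} t \<partial>lborel) \<le> ennreal (u y - u a)"
proof (rule ennreal_le_epsilon)
  fix e :: real assume e: "0 < e"
  obtain N :: nat where N: "(y - a) / e < real N" using reals_Archimedean2 by blast
  have N0: "0 < N" using N e \<open>a \<le> y\<close> by (cases N) (auto simp: divide_less_0_iff)
  then obtain K where K: "N = Suc K" by (cases N) auto
  define h where "h = (y - a) / real N"
  have h: "0 \<le> h" "h \<le> e" using N N0 e \<open>a \<le> y\<close> by (auto simp: h_def field_simps)
  define c where "c k = a + real k * h" for k :: nat
  have cN: "c N = y" using N0 by (simp add: c_def h_def)
  have c_mono: "c k \<le> c l" if "k \<le> l" for k l using that h by (simp add: c_def mult_right_mono)
  have ca: "a \<le> c k" for k using c_mono[of 0 k] by (simp add: c_def)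
  have u_mono: "u s \<le> u t" if "a \<le> s" "s \<le> t" "t \<le> y" for s t
    using sub[OF that] x01[of s] that mult_nonneg_nonneg[of "t - s" "x s"] by linarith
  have slice: "(\<integral>\<^sup>+t. ennreal (x t) * indicator {c k<..c (Suc k)} t \<partial>lborel) \<le> ennreal (h * C)"
    if "\<And>t. c k < t \<Longrightarrow> t \<le> c (Suc k) \<Longrightarrow> x t \<le> C" "0 \<le> C" for k C
  proof -
    have "(\<integral>\<^sup>+t. ennreal (x t) * indicator {c k<..c (Suc k)} t \<partial>lborel) \<le> (\<integral>\<^sup>+t. ennreal C * indicator {c k<..c (Suc k)} t \<partial>lborel)"
      using that by (intro nn_integral_mono) (auto split: split_indicator intro!: ennreal_leI)
    also have "\<dots> = ennreal C * ennreal (c (Suc k) - c k)"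
      using c_mono[of k "Suc k"] by (subst nn_integral_cmult_indicator) auto
    also have "c (Suc k) - c k = h" by (simp add: c_def algebra_simps)
    also have "ennreal C * ennreal h = ennreal (h * C)" using that h by (simp add: ennreal_mult mult.commute)
    finally show ?thesis .
  qed
  have split: "(\<integral>\<^sup>+t. ennreal (x t) * indicator {a<..c (Suc k)} t \<partial>lborel) =
      (\<integral>\<^sup>+t. ennreal (x t) * indicator {a<..c k} t \<partial>lborel) + (\<integral>\<^sup>+t. ennreal (x t) * indicator {c k<..c (Suc k)} t \<partial>lborel)" for k
    using ca[of k] c_mono[of k "Suc k"]
    by (subst nn_integral_add[symmetric]) (auto intro!: nn_integral_cong split: split_indicator)
  \<comment> \<open>On each slice \<open>x\<close> is at most its value at the right end, and the
    step length times that value is bounded by the growth of \<open>u\<close> over the following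
    slice. The last slice has no successor; it contributes at most its length, which is below
    \<open>e\<close>.\<close>
  have "(\<integral>\<^sup>+t. ennreal (x t) * indicator {a<..c k} t \<partial>lborel) \<le> ennreal (u (c (Suc k)) - u (c 1))" if "Suc k \<le> N" for k
    using that
  proof (induction k)
    case 0
    show ?case by (simp add: c_def)
  next
    case (Suc k)
    have le: "c (Suc (Suc k)) \<le> y" using c_mono[OF Suc.prems] cN by simp
    have cc: "c (Suc k) \<le> c (Suc (Suc k))" "c 1 \<le> c (Suc k)" by (auto intro!: c_mono)
    have "(\<integral>\<^sup>+t. ennreal (x t) * indicator {c k<..c (Suc k)} t \<partial>lborel) \<le> ennreal (h * x (c (Suc k)))"
    proof (rule slice)
      show "x t \<le> x (c (Suc k))" if "c k < t" "t \<le> c (Suc k)" for t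
        using that ca[of k] le cc by (intro mono) auto
      show "0 \<le> x (c (Suc k))" using x01 ca[of "Suc k"] le cc by simp
    qed
    also have "\<dots> \<le> ennreal (u (c (Suc (Suc k))) - u (c (Suc k)))"
      using sub[of "c (Suc k)" "c (Suc (Suc k))"] ca[of "Suc k"] le cc
      by (intro ennreal_leI) (auto simp: c_def algebra_simps)
    finally have "(\<integral>\<^sup>+t. ennreal (x t) * indicator {a<..c (Suc k)} t \<partial>lborel)
       \<le> ennreal (u (c (Suc k)) - u (c 1)) + ennreal (u (c (Suc (Suc k))) - u (c (Suc k)))"
      unfolding split using Suc by (intro add_mono) auto
    also have "\<dots> = ennreal (u (c (Suc (Suc k))) - u (c 1))"
      using u_mono[of "c 1" "c (Suc k)"] u_mono[of "c (Suc k)" "c (Suc (Suc k))"] ca[of 1] ca[of "Suc k"] le cc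
      by (subst ennreal_plus[symmetric]) auto
    finally show ?case .
  qed
  from this[of K] have "(\<integral>\<^sup>+t. ennreal (x t) * indicator {a<..c K} t \<partial>lborel) \<le> ennreal (u y - u (c 1))"
    using K cN by simp
  also have "\<dots> \<le> ennreal (u y - u a)"
    using u_mono[of a "c 1"] ca[of 1] c_mono[of 1 N] N0 cN by (intro ennreal_leI) auto
  finally have init: "(\<integral>\<^sup>+t. ennreal (x t) * indicator {a<..c K} t \<partial>lborel) \<le> ennreal (u y - u a)" .
  have "(\<integral>\<^sup>+t. ennreal (x t) * indicator {c K<..c (Suc K)} t \<partial>lborel) \<le> ennreal (h * 1)"
    using x01 ca[of K] cN K by (intro slice) auto
  also have "\<dots> \<le> ennreal e" using h by (intro ennreal_leI) auto
  finally have "(\<integral>\<^sup>+t. ennreal (x t) * indicator {c K<..c (Suc K)} t \<partial>lborel) \<le> ennreal e" .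
  from add_mono[OF init this] show "(\<integral>\<^sup>+t. ennreal (x t) * indicator {a<..y} t \<partial>lborel) \<le> ennreal (u y - u a) + ennreal e"
    unfolding split[symmetric] using cN K by simp
qed

text \<open>The virtual value of the law conditioned on values at most \<open>T\<close>.\<close>

definition (in pdf_dist) trunc_virtual :: "real \<Rightarrow> real \<Rightarrow> real" where
  "trunc_virtual T y = y - (F T - F y) / f y"

lemma (in pdf_dist) trunc_virtual_measurable [measurable]: "trunc_virtual T \<in> borel_measurable borel"
  unfolding trunc_virtual_def by measurable

text \<open>What one bidder faces once the bids of the others are fixed.\<close>

locale single_buyer = pdf_dist +
  fixes x p :: "real \<Rightarrow> real"
  assumes x_measurable [measurable]: "x \<in> borel_measurable borel"
    and p_measurable [measurable]: "p \<in> borel_measurable borel"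
    and x01: "\<And>y. y \<in> D \<Longrightarrow> 0 \<le> x y \<and> x y \<le> 1"
    and IC: "\<And>y b. y \<in> D \<Longrightarrow> b \<in> D \<Longrightarrow> y * x b - p b \<le> y * x y - p y"
    and IR: "\<And>y. y \<in> D \<Longrightarrow> 0 \<le> y * x y - p y"
begin

definition u :: "real \<Rightarrow> real" where "u y = y * x y - p y"

lemma u_measurable [measurable]: "u \<in> borel_measurable borel"
  unfolding u_def by measurable

lemma subgradient: "b \<in> D \<Longrightarrow> y \<in> D \<Longrightarrow> (y - b) * x b \<le> u y - u b"
  using IC[of y b] by (simp add: u_def algebra_simps)

lemma x_mono: assumes "s \<in> D" "t \<in> D" "s \<le> t" shows "x s \<le> x t"
proof (cases "s = t")
  case False
  have "(t - s) * x s \<le> (t - s) * x t"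
    using subgradient[of s t] subgradient[of t s] assms by (simp add: algebra_simps)
  thus ?thesis using False assms by simp
qed simp

text \<open>The envelope inequality: incentive compatibility makes \<open>x\<close> a subgradient of
  the utility, and individual rationality makes the utility nonnegative at the start. As
  \<open>D\<close> may lack its infimum, the start is a point of \<open>D\<close> within
  \<open>e\<close> of it, and the part below costs at most \<open>e\<close> since \<open>x\<close>
  is at most 1.\<close>

lemma envelope:
  assumes y: "y \<in> D"
  shows "(\<integral>\<^sup>+t. ennreal (x t) * indicator (D \<inter> {..y}) t \<partial>lborel) \<le> ennreal (u y)"
proof (rule ennreal_le_epsilon)
  fix e :: real assume e: "0 < e"
  have bdd: "bdd_below D" by (rule bdd_belowI[of _ 0]) (rule D_nonneg)
  obtain a0 where a0: "a0 \<in> D" "a0 < Inf D + e"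
    using cInf_lessD[of D "Inf D + e"] y e by auto
  define a where "a = min a0 y"
  have a: "a \<in> D" "a \<le> y" "a < Inf D + e" using a0 y by (auto simp: a_def min_def)
  have sub: "s \<in> D" if "a \<le> s" "s \<le> y" for s
    using interval_D a y that unfolding is_interval_1 by blast
  have "(\<integral>\<^sup>+t. ennreal (x t) * indicator (D \<inter> {..y}) t \<partial>lborel) \<le>
      (\<integral>\<^sup>+t. ennreal (x t) * indicator {a<..y} t + indicator {a - e..a} t \<partial>lborel)"
  proof (rule nn_integral_mono)
    fix t
    have "a - e \<le> t" "ennreal (x t) \<le> 1" if "t \<in> D"
      using cInf_lower[OF that bdd] a x01[OF that] by auto
    thus "ennreal (x t) * indicator (D \<inter> {..y}) t \<le> ennreal (x t) * indicator {a<..y} t + indicator {a - e..a} t"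
      by (auto split: split_indicator)
  qed
  also have "\<dots> = (\<integral>\<^sup>+t. ennreal (x t) * indicator {a<..y} t \<partial>lborel) + (\<integral>\<^sup>+t. indicator {a - e..a} t \<partial>lborel)"
    by (rule nn_integral_add) measurable
  also have "\<dots> \<le> ennreal (u y - u a) + ennreal e"
  proof (rule add_mono)
    show "(\<integral>\<^sup>+t. ennreal (x t) * indicator {a<..y} t \<partial>lborel) \<le> ennreal (u y - u a)"
      
      by (rule nn_integral_subgradient_le[OF x_measurable a(2)])
        (simp_all add: sub subgradient x_mono x01)
  qed (use e in simp)
  also have "\<dots> \<le> ennreal (u y) + ennreal e"
    using IR[OF a(1)] by (intro add_mono ennreal_leI) (auto simp: u_def)
  finally show "(\<integral>\<^sup>+t. ennreal (x t) * indicator (D \<inter> {..y}) t \<partial>lborel) \<le> ennreal (u y) + ennreal e" .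
qed

text \<open>Payments may be unbounded below a priori, but the subgradient inequality lets the
  utility exceed that of a fixed type \<open>b\<close> by at most the distance to \<open>b\<close>,
  and individual rationality bounds it below.\<close>

lemma integrable_u: "integrable M (\<lambda>y. u y * indicator {..T} y)"
proof -
  obtain b where b: "b \<in> D" using ex_quantile[of "1/2"] by auto
  show ?thesis
  proof (rule integrable_const_bound)
    show "AE y in M. norm (u y * indicator {..T} y) \<le> u b + b + \<bar>T\<bar>"
      using AE_D
    proof eventually_elim
      case (elim y)
      have "u y \<le> u b + (y - b) * x y" using subgradient[OF elim b] by (simp add: algebra_simps)
      moreover have "(y - b) * x y \<le> \<bar>y - b\<bar> * 1"
        using x01[OF elim] by (intro mult_mono) auto
      moreover have "0 \<le> u y" "0 \<le> u b" using IR elim b by (auto simp: u_def)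
      ultimately show ?case using D_nonneg[OF elim] D_nonneg[OF b]
        by (auto split: split_indicator)
    qed
  qed measurable
qed

text \<open>The envelope inequality is integrated over the values up to \<open>T\<close>. After
  Tonelli each type \<open>t\<close> is counted with the mass of \<open>{t..T}\<close>, and dividing
  by the density gives exactly the correction term of \<open>trunc_virtual\<close>.\<close>

lemma revenue_le_virtual_surplus:
  "0 \<le> (\<integral>y. (x y * trunc_virtual T y - p y) * indicator {..T} y \<partial>M)"
  "integrable M (\<lambda>y. (x y * trunc_virtual T y - p y) * indicator {..T} y)"
proof -
  \<comment> \<open>The information rent, whose integral is a lower bound for the expected utility
    on values up to \<open>T\<close>.\<close>
  define r where "r y = x y * ((F T - F y) / f y) * indicator {..T} y * indicator D y" for y
  have [measurable]: "r \<in> borel_measurable borel" unfolding r_def by measurable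
  have r0: "0 \<le> r y" for y
    using x01[of y] F_mono[of y T] f_nonneg[of y] by (auto simp: r_def split: split_indicator)
  have "(\<integral>\<^sup>+y. ennreal (r y) \<partial>M) = (\<integral>\<^sup>+y. ennreal (f y) * ennreal (r y) \<partial>lborel)"
    by (rule nn_integral_M) measurable
  also have "\<dots> = (\<integral>\<^sup>+t. ennreal (x t) * indicator D t * emeasure M {t..T} \<partial>lborel)"
  proof (rule nn_integral_cong)
    fix t
    show "ennreal (f t) * ennreal (r t) = ennreal (x t) * indicator D t * emeasure M {t..T}"
    proof (cases "t \<in> D \<and> t \<le> T")
      case True
      have "emeasure M {t..T} = emeasure M {t<..T}"
        by (rule emeasure_eq_AE, use AE_neq[of t] in eventually_elim) auto
      also have "\<dots> = ennreal (F T - F t)" using measure_Ioc[of t T] True by (simp add: emeasure_eq_measure)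
      finally show ?thesis
        using True x01[of t] f_pos[of t] F_mono[of t T]
        by (simp add: r_def ennreal_mult[symmetric])
    qed (auto simp: r_def split: split_indicator)
  qed
  also have "\<dots> = (\<integral>\<^sup>+t. (\<integral>\<^sup>+y. ennreal (x t) * indicator D t * (if t \<le> y \<and> y \<le> T then 1 else 0) \<partial>M) \<partial>lborel)"
  proof (rule nn_integral_cong)
    fix t
    have "(\<integral>\<^sup>+y. ennreal (x t) * indicator D t * (if t \<le> y \<and> y \<le> T then 1 else 0) \<partial>M) =
       (\<integral>\<^sup>+y. ennreal (x t) * indicator D t * indicator {t..T} y \<partial>M)"
      by (rule nn_integral_cong) (auto split: split_indicator)
    thus "ennreal (x t) * indicator D t * emeasure M {t..T} =
       (\<integral>\<^sup>+y. ennreal (x t) * indicator D t * (if t \<le> y \<and> y \<le> T then 1 else 0) \<partial>M)"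
      by (simp add: nn_integral_cmult_indicator)
  qed
  also have "\<dots> = (\<integral>\<^sup>+y. (\<integral>\<^sup>+t. ennreal (x t) * indicator D t * (if t \<le> y \<and> y \<le> T then 1 else 0) \<partial>lborel) \<partial>M)"
  proof (rule pair_sigma_finite.Fubini')
    show "pair_sigma_finite M lborel" by (simp add: pair_sigma_finite_def sigma_finite_measure_axioms lborel.sigma_finite_measure_axioms)
  qed measurable
  also have "\<dots> \<le> (\<integral>\<^sup>+y. ennreal (u y * indicator {..T} y) \<partial>M)"
  proof (rule nn_integral_mono_AE, use AE_D in eventually_elim)
    case (elim y)
    have "(\<integral>\<^sup>+t. ennreal (x t) * indicator D t * (if t \<le> y \<and> y \<le> T then 1 else 0) \<partial>lborel) =
       (\<integral>\<^sup>+t. ennreal (x t) * indicator (D \<inter> {..y}) t * indicator {..T} y \<partial>lborel)"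
      by (rule nn_integral_cong) (auto split: split_indicator)
    also have "\<dots> \<le> ennreal (u y * indicator {..T} y)"
      using envelope[OF elim] by (auto split: split_indicator)
    finally show ?case .
  qed
  also have "\<dots> = ennreal (\<integral>y. u y * indicator {..T} y \<partial>M)"
    by (rule nn_integral_eq_integral[OF integrable_u], use AE_D in eventually_elim)
       (use IR in \<open>auto simp: u_def split: split_indicator\<close>)
  finally have le: "(\<integral>\<^sup>+y. ennreal (r y) \<partial>M) \<le> ennreal (\<integral>y. u y * indicator {..T} y \<partial>M)" .
  have ir: "integrable M r"
    by (rule integrableI_nonneg) (use r0 le_less_trans[OF le] in simp_all)
  have "ennreal (\<integral>y. r y \<partial>M) \<le> ennreal (\<integral>y. u y * indicator {..T} y \<partial>M)"
    using le nn_integral_eq_integral[OF ir] r0 by simp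
  moreover have "0 \<le> (\<integral>y. u y * indicator {..T} y \<partial>M)"
    by (rule integral_nonneg_AE, use AE_D in eventually_elim)
       (use IR in \<open>auto simp: u_def split: split_indicator\<close>)
  ultimately have rle: "(\<integral>y. r y \<partial>M) \<le> (\<integral>y. u y * indicator {..T} y \<partial>M)" by simp
  have ae: "AE y in M. u y * indicator {..T} y - r y = (x y * trunc_virtual T y - p y) * indicator {..T} y"
    using AE_D by eventually_elim
      (auto simp: u_def r_def trunc_virtual_def algebra_simps split: split_indicator)
  have i: "integrable M (\<lambda>y. u y * indicator {..T} y - r y)" using integrable_u ir by simp
  show "integrable M (\<lambda>y. (x y * trunc_virtual T y - p y) * indicator {..T} y)"
    by (rule integrable_cong_AE_imp[OF i _ ae]) measurable
  have "(\<integral>y. (x y * trunc_virtual T y - p y) * indicator {..T} y \<partial>M) = (\<integral>y. u y * indicator {..T} y - r y \<partial>M)"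
    by (rule integral_cong_AE[OF _ _ AE_symmetric[OF ae]]) measurable
  thus "0 \<le> (\<integral>y. (x y * trunc_virtual T y - p y) * indicator {..T} y \<partial>M)"
    using rle integrable_u ir by simp
qed

end

section \<open>Truncated distributions\<close>

context regular_dist
begin

text \<open>If the density does not rise from \<open>s\<close> to \<open>t\<close>, the quotient is
  \<open>psi\<close> minus \<open>(1 - F T) / f\<close>, and the subtracted term does not fall, so
  the slope bound on \<open>psi\<close> survives. If the density rises, the quotient itself falls,
  since its numerator does too.\<close>

lemma trunc_virtual_mono_lam:
  assumes "s \<in> D" "t \<in> D" "s \<le> t" "t \<le> T"
  shows "lam * s - (F T - F s) / f s \<le> lam * t - (F T - F t) / f t"
proof (cases "f t \<le> f s")
  case True
  have "psi t \<le> psi s + lam * (t - s)" by (rule psi_le) fact+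
  moreover have "(1 - F T) / f s \<le> (1 - F T) / f t"
    using True F_le1[of T] f_pos assms by (intro divide_left_mono) auto
  moreover have "(F T - F s) / f s = psi s - (1 - F T) / f s" "(F T - F t) / f t = psi t - (1 - F T) / f t"
    by (simp_all add: psi_def diff_divide_distrib)
  ultimately show ?thesis by (simp add: algebra_simps)
next
  case False
  have "(F T - F t) / f t \<le> (F T - F s) / f s"
    using False F_mono[of s t] F_mono[of t T] f_pos assms by (intro frac_le) auto
  moreover have "lam * s \<le> lam * t" using assms lam_pos by simp
  ultimately show ?thesis by linarith
qed

lemma trunc_virtual_mono:
  assumes "s \<in> D" "t \<in> D" "s \<le> t" "t \<le> T"
  shows "trunc_virtual T s \<le> trunc_virtual T t"
proof -
  have "lam * (t - s) \<le> t - s" using assms lam_le1 by (intro mult_left_le_one_le) (use lam_pos in auto)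
  thus ?thesis using trunc_virtual_mono_lam[OF assms] by (simp add: trunc_virtual_def algebra_simps)
qed

definition trunc_pdf :: "real \<Rightarrow> real \<Rightarrow> real" where
  "trunc_pdf T y = f y * indicator {..T} y / F T"

definition trunc :: "real \<Rightarrow> real measure" where
  "trunc T = density lborel (\<lambda>y. ennreal (trunc_pdf T y))"

lemma trunc_eq:
  assumes "0 < F T"
  shows "trunc T = density M (\<lambda>y. ennreal (indicator {..T} y / F T))"
proof -
  have "trunc T = density lborel (\<lambda>y. ennreal (f y) * ennreal (indicator {..T} y / F T))"
    unfolding trunc_def trunc_pdf_def using f_nonneg assms
    by (simp flip: ennreal_mult)
  also have "\<dots> = density (density lborel (\<lambda>y. ennreal (f y))) (\<lambda>y. ennreal (indicator {..T} y / F T))"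
    by (rule density_density_eq[symmetric]) measurable
  also have "\<dots> = density M (\<lambda>y. ennreal (indicator {..T} y / F T))"
    unfolding M_eq[symmetric] ..
  finally show ?thesis .
qed

lemma emeasure_trunc:
  assumes "0 < F T"
  shows "emeasure (trunc T) {..y} = ennreal (F (min y T) / F T)"
proof -
  have "emeasure (trunc T) {..y} = (\<integral>\<^sup>+z. ennreal (indicator {..T} z / F T) * indicator {..y} z \<partial>M)"
    unfolding trunc_eq[OF assms] by (rule emeasure_density) auto
  also have "\<dots> = (\<integral>\<^sup>+z. ennreal (1 / F T) * indicator {..min y T} z \<partial>M)"
    by (rule nn_integral_cong) (auto split: split_indicator)
  also have "\<dots> = ennreal (1 / F T) * ennreal (F (min y T))"
    by (subst nn_integral_cmult_indicator) (auto simp: emeasure_eq_measure cdf_def2)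
  finally show ?thesis using assms F_ge0 by (simp add: ennreal_mult[symmetric])
qed

lemma cdf_trunc: "0 < F T \<Longrightarrow> cdf (trunc T) y = F (min y T) / F T"
  using emeasure_trunc[of T y] F_ge0[of "min y T"] by (simp add: cdf_def measure_def)

lemma regular_trunc:
  assumes T: "0 < F T"
  shows "regular_dist (trunc T) (trunc_pdf T) (D \<inter> {..T}) lam"
proof
  have "emeasure (trunc T) UNIV = (\<integral>\<^sup>+z. ennreal (indicator {..T} z / F T) * indicator UNIV z \<partial>M)"
    unfolding trunc_eq[OF T] by (rule emeasure_density) auto
  also have "\<dots> = (\<integral>\<^sup>+z. ennreal (1 / F T) * indicator {..T} z \<partial>M)"
    by (rule nn_integral_cong) (auto split: split_indicator)
  also have "\<dots> = ennreal (1 / F T) * ennreal (F T)"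
    by (subst nn_integral_cmult_indicator) (auto simp: emeasure_eq_measure cdf_def2)
  also have "\<dots> = 1" using T by (simp add: ennreal_mult[symmetric])
  finally have "prob_space (trunc T)"
    by (intro prob_spaceI) (simp add: trunc_def)
  moreover have "is_interval (D \<inter> {..T})" using interval_D by (intro is_interval_Int) auto
  moreover have "trunc_pdf T \<in> borel_measurable borel"
    unfolding trunc_pdf_def by measurable
  ultimately show "has_pdf_on (trunc T) (trunc_pdf T) (D \<inter> {..T})"
    unfolding has_pdf_on_def using D_nonneg f_pos f_zero T
    by (auto simp: trunc_def trunc_pdf_def indicator_def)
  show "mono_on (D \<inter> {..T}) (virtual_value lam (trunc T) (trunc_pdf T))"
  proof (rule mono_onI)
    fix s t assume st: "s \<in> D \<inter> {..T}" "t \<in> D \<inter> {..T}" "s \<le> t"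
    have "virtual_value lam (trunc T) (trunc_pdf T) y = lam * y - (F T - F y) / f y" if "y \<in> D" "y \<le> T" for y
      using that T f_pos[of y] by (simp add: virtual_value_def cdf_trunc trunc_pdf_def min_def field_simps)
    thus "virtual_value lam (trunc T) (trunc_pdf T) s \<le> virtual_value lam (trunc T) (trunc_pdf T) t"
      using trunc_virtual_mono_lam[of s t T] st by simp
  qed
qed (fact lam_pos lam_le1)+

end

section \<open>Truthful auctions\<close>

locale truthful_dist = regular_dist +
  fixes n :: nat and x p :: "(nat \<Rightarrow> real) \<Rightarrow> nat \<Rightarrow> real"
  assumes n_ge2: "2 \<le> n" and truthful: "truthful_auction M D n x p"
begin

abbreviation V :: "(nat \<Rightarrow> real) measure" where "V \<equiv> PiM {..<n} (\<lambda>_. M)"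

abbreviation total :: "(nat \<Rightarrow> real) \<Rightarrow> real" where "total v \<equiv> \<Sum>i<n. p v i"

lemma x_measurable: "i < n \<Longrightarrow> (\<lambda>v. x v i) \<in> borel_measurable V"
  and p_measurable: "i < n \<Longrightarrow> (\<lambda>v. p v i) \<in> borel_measurable V"
  and integrable_total: "integrable V total"
  using truthful by (auto simp: truthful_auction_def valuations_def)

lemma x_nonneg: "v \<in> {..<n} \<rightarrow>\<^sub>E D \<Longrightarrow> i < n \<Longrightarrow> 0 \<le> x v i"
  and x_sum: "v \<in> {..<n} \<rightarrow>\<^sub>E D \<Longrightarrow> (\<Sum>i<n. x v i) \<le> 1"
  and IC: "v \<in> {..<n} \<rightarrow>\<^sub>E D \<Longrightarrow> i < n \<Longrightarrow> b \<in> D \<Longrightarrow>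
     v i * x (v(i := b)) i - p (v(i := b)) i \<le> v i * x v i - p v i"
  and IR: "v \<in> {..<n} \<rightarrow>\<^sub>E D \<Longrightarrow> i < n \<Longrightarrow> 0 \<le> v i * x v i - p v i"
  using truthful by (auto simp: truthful_auction_def)

lemma x_le1: assumes "v \<in> {..<n} \<rightarrow>\<^sub>E D" "i < n" shows "x v i \<le> 1"
proof -
  have "x v i \<le> (\<Sum>i<n. x v i)"
    using assms x_nonneg by (intro member_le_sum) auto
  thus ?thesis using x_sum[OF assms(1)] by linarith
qed

lemma AE_coordinates: "finite I \<Longrightarrow> AE v in PiM I (\<lambda>_. M). v \<in> I \<rightarrow>\<^sub>E D"
proof -
  assume fin: "finite I"
  have "AE v in PiM I (\<lambda>_. M). v i \<in> D" if "i \<in> I" for i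
    by (rule AE_PiM_component[OF _ that AE_D]) (rule prob_space_axioms)
  hence "AE v in PiM I (\<lambda>_. M). \<forall>i\<in>I. v i \<in> D"
    using fin by (subst AE_finite_all) auto
  thus ?thesis using AE_space
    by eventually_elim (auto simp: space_PiM PiE_iff)
qed

lemma integrable_coordinate:
  fixes g :: "real \<Rightarrow> real"
  assumes "i < n" "integrable M g" shows "integrable V (\<lambda>v. g (v i))"
proof (rule integrable_distr[of "\<lambda>v. v i" V M g])
  show "(\<lambda>v. v i) \<in> measurable V M" using assms by simp
  have "distr V M (\<lambda>v. v i) = M"
    using assms by (intro distr_PiM_component[of "{..<n}" "\<lambda>_. M"]) (auto intro: prob_space_axioms)
  thus "integrable (distr V M (\<lambda>v. v i)) g" using assms by simp
qed

text \<open>The product form lets the factor of one bidder be separated from those of the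
  others.\<close>

definition cutoff :: "real \<Rightarrow> (nat \<Rightarrow> real) \<Rightarrow> real" where
  "cutoff T v = (\<Prod>j<n. indicator {..T} (v j))"

lemma cutoff_measurable [measurable]: "cutoff T \<in> borel_measurable V"
  unfolding cutoff_def
proof (rule borel_measurable_prod)
  fix j assume "j \<in> {..<n}"
  hence [measurable]: "(\<lambda>v. v j) \<in> borel_measurable V"
    using measurable_component_singleton[of j "{..<n}" "\<lambda>_. M"] by simp
  show "(\<lambda>v. indicator {..T} (v j) :: real) \<in> borel_measurable V" by measurable
qed

lemma cutoff_eq: "cutoff T v = (if \<forall>j<n. v j \<le> T then 1 else 0)"
  unfolding cutoff_def by (auto simp: prod_zero_iff split: split_indicator)

text \<open>When all bids are at most \<open>T\<close>, individual rationality bounds every payment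
  by \<open>\<bar>T\<bar>\<close>. Each payment is the integrable total minus the others, so it is
  bounded below by an integrable function as well.\<close>

lemma integrable_payment:
  assumes i: "i < n" shows "integrable V (\<lambda>v. p v i * cutoff T v)"
proof (rule Bochner_Integration.integrable_bound)
  have "prob_space V" by (intro prob_space_PiM prob_space_axioms)
  then interpret V: prob_space V .
  show "integrable V (\<lambda>v. \<bar>total v\<bar> + real n * \<bar>T\<bar>)"
    using integrable_total by auto
  show "(\<lambda>v. p v i * cutoff T v) \<in> borel_measurable V"
    using p_measurable[OF i] by measurable
  show "AE v in V. norm (p v i * cutoff T v) \<le> norm (\<bar>total v\<bar> + real n * \<bar>T\<bar>)"
    using AE_coordinates[OF finite_lessThan]
  proof eventually_elim
    case (elim v)
    show ?case
    proof (cases "\<forall>j<n. v j \<le> T")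
      case True
      have le: "p v j \<le> \<bar>T\<bar>" if "j < n" for j
      proof -
        have "0 \<le> v j" using PiE_mem[OF elim, of j] that by (simp add: D_nonneg)
        moreover have "v j \<le> \<bar>T\<bar>" using True that abs_ge_self[of T] by fastforce
        ultimately have "v j * x v j \<le> \<bar>T\<bar> * 1"
          using x_le1[OF elim that] x_nonneg[OF elim that] by (intro mult_mono) auto
        thus ?thesis using IR[OF elim that] by simp
      qed
      have "total v = p v i + (\<Sum>j\<in>{..<n} - {i}. p v j)"
        using i by (subst sum.remove[of _ i]) auto
      moreover have "(\<Sum>j\<in>{..<n} - {i}. p v j) \<le> real (card ({..<n} - {i})) * \<bar>T\<bar>"
        by (rule sum_bounded_above) (use le in auto)
      moreover have "real (card ({..<n} - {i})) * \<bar>T\<bar> \<le> real n * \<bar>T\<bar>"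
        using i by (intro mult_right_mono) auto
      moreover have "\<bar>T\<bar> \<le> real n * \<bar>T\<bar>"
        using n_ge2 mult_right_mono[of 1 "real n" "\<bar>T\<bar>"] by simp
      ultimately show ?thesis using le[OF i] True by (simp add: cutoff_eq)
    next
      case False
      hence "cutoff T v = 0" by (simp add: cutoff_eq)
      thus ?thesis by simp
    qed
  qed
qed

text \<open>Giving the item away for free is a truthful mechanism whose virtual surplus is the
  truncated virtual value itself.\<close>

lemma integrable_trunc_virtual: "integrable M (\<lambda>y. trunc_virtual T y * indicator {..T} y)"
proof -
  interpret single_buyer M f D "\<lambda>_. 1" "\<lambda>_. 0"
    by unfold_locales (auto simp: D_nonneg)
  show ?thesis using revenue_le_virtual_surplus(2)[of T] by simp
qed

lemma trunc_virtual_coordinate_measurable: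
  assumes "i < n" shows "(\<lambda>v. trunc_virtual T (v i)) \<in> borel_measurable V"
  using measurable_compose[OF measurable_component_singleton[of i "{..<n}" "\<lambda>_. M"], of "trunc_virtual T" borel] assms
  by simp

lemma integrable_surplus:
  assumes i: "i < n" shows "integrable V (\<lambda>v. x v i * trunc_virtual T (v i) * cutoff T v)"
proof (rule Bochner_Integration.integrable_bound)
  show "integrable V (\<lambda>v. trunc_virtual T (v i) * indicator {..T} (v i))"
    by (rule integrable_coordinate[OF i integrable_trunc_virtual])
  show "(\<lambda>v. x v i * trunc_virtual T (v i) * cutoff T v) \<in> borel_measurable V"
    using x_measurable[OF i] trunc_virtual_coordinate_measurable[OF i] by measurable
  show "AE v in V. norm (x v i * trunc_virtual T (v i) * cutoff T v) \<le> norm (trunc_virtual T (v i) * indicator {..T} (v i))"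
    using AE_coordinates[OF finite_lessThan]
  proof eventually_elim
    case (elim v)
    have "\<bar>x v i\<bar> * \<bar>trunc_virtual T (v i)\<bar> \<le> \<bar>trunc_virtual T (v i)\<bar>"
      using x_nonneg[OF elim i] x_le1[OF elim i] by (intro mult_left_le_one_le) auto
    thus ?case using i by (auto simp: cutoff_eq abs_mult)
  qed
qed

text \<open>Fubini over the bids of the others: for almost every choice of these, the one-buyer
  inequality applies, and their share of the cutoff is a nonnegative constant.\<close>

lemma payment_le_surplus:
  assumes i: "i < n"
  shows "(\<integral>v. p v i * cutoff T v \<partial>V) \<le> (\<integral>v. x v i * trunc_virtual T (v i) * cutoff T v \<partial>V)"
proof -
  interpret product_sigma_finite "\<lambda>_::nat. M"
    by (rule product_sigma_finite.intro) (rule sigma_finite_measure_axioms)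
  define I where "I = {..<n} - {i}"
  have I: "finite I" "i \<notin> I" "insert i I = {..<n}" using i by (auto simp: I_def)
  define d where "d v = x v i * trunc_virtual T (v i) * cutoff T v - p v i * cutoff T v" for v
  have int_d: "integrable V d"
    unfolding d_def using integrable_payment[OF i] integrable_surplus[OF i] by simp
  have "integral\<^sup>L V d = (\<integral>v. (\<integral>y. d (v(i := y)) \<partial>M) \<partial>PiM I (\<lambda>_. M))"
    using product_integral_insert[OF I(1,2), of d] int_d unfolding I(3) by simp
  also have "\<dots> \<ge> 0"
  proof (rule integral_nonneg_AE)
    show "AE v in PiM I (\<lambda>_. M). 0 \<le> (\<integral>y. d (v(i := y)) \<partial>M)"
      using AE_coordinates[OF I(1)] AE_space
    proof eventually_elim
      case (elim v)
      have upd: "v(i := y) \<in> {..<n} \<rightarrow>\<^sub>E D" if "y \<in> D" for y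
        using elim(1) that I by (auto simp: PiE_iff extensional_def)
      have upd_meas: "(\<lambda>y. v(i := y)) \<in> measurable M V"
        using measurable_component_update[OF elim(2) I(2)] unfolding I(3) .
      interpret b: single_buyer M f D "\<lambda>y. x (v(i := y)) i" "\<lambda>y. p (v(i := y)) i"
      proof
        show "(\<lambda>y. x (v(i := y)) i) \<in> borel_measurable borel"
          using measurable_compose[OF upd_meas x_measurable[OF i]] by simp
        show "(\<lambda>y. p (v(i := y)) i) \<in> borel_measurable borel"
          using measurable_compose[OF upd_meas p_measurable[OF i]] by simp
        fix y assume y: "y \<in> D"
        show "0 \<le> x (v(i := y)) i \<and> x (v(i := y)) i \<le> 1"
          using x_nonneg x_le1 upd[OF y] i by blast
        show "0 \<le> y * x (v(i := y)) i - p (v(i := y)) i"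
          using IR[OF upd[OF y] i] by simp
        fix b assume "b \<in> D"
        thus "y * x (v(i := b)) i - p (v(i := b)) i \<le> y * x (v(i := y)) i - p (v(i := y)) i"
          using IC[OF upd[OF y] i] by simp
      qed
      define c :: real where "c = (\<Prod>j\<in>I. indicator {..T} (v j))"
      have c: "0 \<le> c" unfolding c_def by (intro prod_nonneg) auto
      have "cutoff T (v(i := y)) = indicator {..T} y * c" for y
      proof -
        have "cutoff T (v(i := y)) = (\<Prod>j\<in>insert i I. indicator {..T} ((v(i := y)) j))"
          unfolding cutoff_def I(3) ..
        also have "\<dots> = indicator {..T} ((v(i := y)) i) * (\<Prod>j\<in>I. indicator {..T} ((v(i := y)) j))"
          by (rule prod.insert[OF I(1,2)])
        also have "(v(i := y)) i = y" by simp
        also have "(\<Prod>j\<in>I. indicator {..T} ((v(i := y)) j)) = c"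
          unfolding c_def using I by (intro prod.cong) auto
        finally show ?thesis .
      qed
      hence "d (v(i := y)) = c * ((x (v(i := y)) i * trunc_virtual T y - p (v(i := y)) i) * indicator {..T} y)" for y
        by (simp add: d_def algebra_simps)
      hence "(\<integral>y. d (v(i := y)) \<partial>M) = c * (\<integral>y. (x (v(i := y)) i * trunc_virtual T y - p (v(i := y)) i) * indicator {..T} y \<partial>M)"
        by simp
      thus ?case using c b.revenue_le_virtual_surplus(1)[of T] by simp
    qed
  qed
  finally have "0 \<le> integral\<^sup>L V d" .
  moreover have "integral\<^sup>L V d = (\<integral>v. x v i * trunc_virtual T (v i) * cutoff T v \<partial>V) - (\<integral>v. p v i * cutoff T v \<partial>V)"
    unfolding d_def by (rule Bochner_Integration.integral_diff[OF integrable_surplus[OF i] integrable_payment[OF i]])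
  ultimately show ?thesis by linarith
qed

section \<open>Surplus of the highest bidder\<close>

definition capped_surplus :: "real \<Rightarrow> real \<Rightarrow> real" where
  "capped_surplus T y = max 0 (trunc_virtual T y) * indicator {..T} y"

lemma capped_surplus_measurable [measurable]: "capped_surplus T \<in> borel_measurable borel"
  unfolding capped_surplus_def by measurable

lemma capped_surplus_nonneg: "0 \<le> capped_surplus T y" by (simp add: capped_surplus_def)

lemma integrable_capped: "integrable M (\<lambda>y. capped_surplus T y * F y ^ (n - 1))"
proof (rule Bochner_Integration.integrable_bound[OF integrable_trunc_virtual[of T]])
  show "AE y in M. norm (capped_surplus T y * F y ^ (n - 1)) \<le> norm (trunc_virtual T y * indicator {..T} y)"
  proof (rule AE_I2)
    fix y
    have "capped_surplus T y * F y ^ (n - 1) \<le> capped_surplus T y"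
      using F_ge0 F_le1 by (intro mult_left_le capped_surplus_nonneg power_le_one) auto
    also have "\<dots> \<le> \<bar>trunc_virtual T y * indicator {..T} y\<bar>"
      by (auto simp: capped_surplus_def split: split_indicator)
    finally show "norm (capped_surplus T y * F y ^ (n - 1)) \<le> norm (trunc_virtual T y * indicator {..T} y)"
      using capped_surplus_nonneg F_ge0 by (simp add: abs_mult)
  qed
qed measurable

text \<open>With ties several bidders count as winners, which can only enlarge the upper bound taken
  over their sum.\<close>

definition winner_surplus :: "real \<Rightarrow> nat \<Rightarrow> (nat \<Rightarrow> real) \<Rightarrow> real" where
  "winner_surplus T j v = capped_surplus T (v j) * (\<Prod>k\<in>{..<n} - {j}. if v k \<le> v j then 1 else 0)"

lemma winner_surplus_nonneg: "0 \<le> winner_surplus T j v"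
  unfolding winner_surplus_def by (intro mult_nonneg_nonneg capped_surplus_nonneg prod_nonneg) auto

lemma winner_surplus_measurable:
  assumes j: "j < n" shows "winner_surplus T j \<in> borel_measurable V"
proof -
  have "(\<lambda>v. if v k \<le> v j then 1 else 0 :: real) \<in> borel_measurable V" if "k \<in> {..<n} - {j}" for k
  proof -
    have [measurable]: "(\<lambda>v. v k) \<in> borel_measurable V" "(\<lambda>v. v j) \<in> borel_measurable V"
      using measurable_component_singleton[of _ "{..<n}" "\<lambda>_. M"] that j by simp_all
    show ?thesis by measurable
  qed
  hence [measurable]: "(\<lambda>v. \<Prod>k\<in>{..<n} - {j}. if v k \<le> v j then 1 else 0 :: real) \<in> borel_measurable V"
    by (rule borel_measurable_prod)
  have [measurable]: "(\<lambda>v. capped_surplus T (v j)) \<in> borel_measurable V"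
    using measurable_compose[OF measurable_component_singleton[of j "{..<n}" "\<lambda>_. M"], of "capped_surplus T" borel] j
    by simp
  show ?thesis unfolding winner_surplus_def by measurable
qed

lemma winner_surplus_integral:
  assumes j: "j < n"
  shows "has_bochner_integral V (winner_surplus T j) (\<integral>y. capped_surplus T y * F y ^ (n - 1) \<partial>M)"
proof (rule has_bochner_integral_nn_integral)
  interpret product_sigma_finite "\<lambda>_::nat. M"
    by (rule product_sigma_finite.intro) (rule sigma_finite_measure_axioms)
  define I where "I = {..<n} - {j}"
  have I: "finite I" "j \<notin> I" "insert j I = {..<n}" "card I = n - 1" using j by (auto simp: I_def)
  show [measurable]: "winner_surplus T j \<in> borel_measurable V" by (rule winner_surplus_measurable[OF j])
  show "AE v in V. 0 \<le> winner_surplus T j v" by (simp add: winner_surplus_nonneg)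
  show "0 \<le> (\<integral>y. capped_surplus T y * F y ^ (n - 1) \<partial>M)"
    by (intro integral_nonneg_AE AE_I2 mult_nonneg_nonneg capped_surplus_nonneg zero_le_power F_ge0)
  have "(\<integral>\<^sup>+v. ennreal (winner_surplus T j v) \<partial>V) =
     (\<integral>\<^sup>+y. (\<integral>\<^sup>+v. ennreal (winner_surplus T j (v(j := y))) \<partial>PiM I (\<lambda>_. M)) \<partial>M)"
    using product_nn_integral_insert_rev[OF I(1,2), of "\<lambda>v. ennreal (winner_surplus T j v)"]
    unfolding I(3) by (simp only: winner_surplus_measurable[OF j] measurable_compose[OF _ measurable_ennreal])
  also have "\<dots> = (\<integral>\<^sup>+y. ennreal (capped_surplus T y * F y ^ (n - 1)) \<partial>M)"
  proof (rule nn_integral_cong)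
    fix y
    have "ennreal (winner_surplus T j (v(j := y))) = ennreal (capped_surplus T y) * indicator (PiE I (\<lambda>_. {..y})) v"
      if "v \<in> space (PiM I (\<lambda>_. M))" for v
    proof -
      have "(\<Prod>k\<in>I. if (v(j := y)) k \<le> y then 1 else 0) = (if v \<in> PiE I (\<lambda>_. {..y}) then 1 else 0 :: real)"
      proof (cases "\<forall>k\<in>I. v k \<le> y")
        case True
        hence "v \<in> PiE I (\<lambda>_. {..y})" using that by (auto simp: space_PiM PiE_iff)
        moreover have "(\<Prod>k\<in>I. if (v(j := y)) k \<le> y then 1 else 0 :: real) = (\<Prod>k\<in>I. 1)"
          using I(2) True by (intro prod.cong) auto
        ultimately show ?thesis by simp
      next
        case False
        then obtain k where k: "k \<in> I" "\<not> v k \<le> y" by blast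
        hence "v \<notin> PiE I (\<lambda>_. {..y})" by (auto simp: PiE_iff)
        moreover have "(\<Prod>k\<in>I. if (v(j := y)) k \<le> y then 1 else 0 :: real) = 0"
          using I(1,2) k by (intro prod_zero bexI[of _ k]) auto
        ultimately show ?thesis by simp
      qed
      thus ?thesis unfolding winner_surplus_def I_def[symmetric] by simp
    qed
    hence "(\<integral>\<^sup>+v. ennreal (winner_surplus T j (v(j := y))) \<partial>PiM I (\<lambda>_. M)) =
       (\<integral>\<^sup>+v. ennreal (capped_surplus T y) * indicator (PiE I (\<lambda>_. {..y})) v \<partial>PiM I (\<lambda>_. M))"
      by (rule nn_integral_cong)
    also have "\<dots> = ennreal (capped_surplus T y) * emeasure (PiM I (\<lambda>_. M)) (PiE I (\<lambda>_. {..y}))"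
      using I by (intro nn_integral_cmult_indicator sets_PiM_I_finite) auto
    also have "emeasure (PiM I (\<lambda>_. M)) (PiE I (\<lambda>_. {..y})) = (\<Prod>k\<in>I. emeasure M {..y})"
      using I by (intro emeasure_PiM) auto
    also have "\<dots> = ennreal (F y ^ (n - 1))"
      unfolding prod_constant I(4) emeasure_eq_measure cdf_def2[symmetric]
      by (rule ennreal_power) (rule F_ge0)
    also have "ennreal (capped_surplus T y) * ennreal (F y ^ (n - 1)) = ennreal (capped_surplus T y * F y ^ (n - 1))"
      using F_ge0 capped_surplus_nonneg by (simp add: ennreal_mult)
    finally show "(\<integral>\<^sup>+v. ennreal (winner_surplus T j (v(j := y))) \<partial>PiM I (\<lambda>_. M)) =
      ennreal (capped_surplus T y * F y ^ (n - 1))" .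
  qed
  also have "\<dots> = ennreal (\<integral>y. capped_surplus T y * F y ^ (n - 1) \<partial>M)"
    using F_ge0 capped_surplus_nonneg by (intro nn_integral_eq_integral integrable_capped) auto
  finally show "(\<integral>\<^sup>+v. ennreal (winner_surplus T j v) \<partial>V) = ennreal (\<integral>y. capped_surplus T y * F y ^ (n - 1) \<partial>M)" .
qed

text \<open>The truncated virtual value increases, so it is largest for a highest bidder, and the
  winning probabilities sum to at most 1.\<close>

lemma surplus_le_winner:
  assumes v: "v \<in> {..<n} \<rightarrow>\<^sub>E D"
  shows "(\<Sum>i<n. x v i * trunc_virtual T (v i) * cutoff T v) \<le> (\<Sum>j<n. winner_surplus T j v)"
proof (cases "\<forall>j<n. v j \<le> T")
  case True
  have ne: "v ` {..<n} \<noteq> {}" using n_ge2 by (auto simp: lessThan_empty_iff)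
  obtain j where j: "j < n" "v j = Max (v ` {..<n})"
    using Max_in[OF _ ne] by auto
  have max: "v k \<le> v j" if "k < n" for k using that by (simp add: j(2))
  have "x v i * trunc_virtual T (v i) * cutoff T v \<le> x v i * capped_surplus T (v j)" if "i < n" for i
  proof -
    have "trunc_virtual T (v i) \<le> trunc_virtual T (v j)"
      using v that j(1) max[OF that] True by (intro trunc_virtual_mono) auto
    also have "\<dots> \<le> capped_surplus T (v j)" using True j(1) by (simp add: capped_surplus_def)
    finally show ?thesis using True x_nonneg[OF v that] by (simp add: cutoff_eq mult_left_mono)
  qed
  hence "(\<Sum>i<n. x v i * trunc_virtual T (v i) * cutoff T v) \<le> (\<Sum>i<n. x v i) * capped_surplus T (v j)"
    unfolding sum_distrib_right by (intro sum_mono) auto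
  also have "\<dots> \<le> 1 * capped_surplus T (v j)"
    by (intro mult_right_mono x_sum v capped_surplus_nonneg)
  also have "\<dots> = winner_surplus T j v" using max by (simp add: winner_surplus_def)
  also have "\<dots> \<le> (\<Sum>j<n. winner_surplus T j v)"
    using j winner_surplus_nonneg by (intro member_le_sum) auto
  finally show ?thesis .
next
  case False
  hence "cutoff T v = 0" by (auto simp: cutoff_eq)
  thus ?thesis by (simp add: sum_nonneg winner_surplus_nonneg)
qed

lemma cutoff_revenue_le:
  "(\<integral>v. total v * cutoff T v \<partial>V) \<le> real n * (\<integral>y. capped_surplus T y * F y ^ (n - 1) \<partial>M)"
proof -
  have "(\<integral>v. total v * cutoff T v \<partial>V) = (\<Sum>i<n. \<integral>v. p v i * cutoff T v \<partial>V)"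
    using integrable_payment by (simp add: sum_distrib_right Bochner_Integration.integral_sum)
  also have "\<dots> \<le> (\<Sum>i<n. \<integral>v. x v i * trunc_virtual T (v i) * cutoff T v \<partial>V)"
    by (intro sum_mono payment_le_surplus) auto
  also have "\<dots> = (\<integral>v. (\<Sum>i<n. x v i * trunc_virtual T (v i) * cutoff T v) \<partial>V)"
    using integrable_surplus by (intro Bochner_Integration.integral_sum[symmetric]) auto
  also have "\<dots> \<le> (\<integral>v. (\<Sum>j<n. winner_surplus T j v) \<partial>V)"
  proof (rule integral_mono_AE)
    show "AE v in V. (\<Sum>i<n. x v i * trunc_virtual T (v i) * cutoff T v) \<le> (\<Sum>j<n. winner_surplus T j v)"
      using AE_coordinates[OF finite_lessThan] by eventually_elim (rule surplus_le_winner)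
  qed (use integrable_surplus winner_surplus_integral in
      \<open>auto intro!: Bochner_Integration.integrable_sum simp: has_bochner_integral_iff\<close>)
  also have "\<dots> = (\<Sum>j<n. \<integral>v. winner_surplus T j v \<partial>V)"
    using winner_surplus_integral by (intro Bochner_Integration.integral_sum) (auto simp: has_bochner_integral_iff)
  also have "\<dots> = (\<Sum>j<n. \<integral>y. capped_surplus T y * F y ^ (n - 1) \<partial>M)"
    using winner_surplus_integral by (intro sum.cong) (auto simp: has_bochner_integral_iff)
  finally show ?thesis by simp
qed

text \<open>The bound is that of the conditioned law, scaled back: the density contributes one
  factor \<open>1 / F T\<close> and the power of the cdf the other \<open>n - 1\<close>.
  Conditioning raises the cdf, so prices earn less and the same \<open>P\<close> serves.\<close>

lemma capped_surplus_le:
  assumes T: "0 < F T" and P: "\<And>q. q \<in> D \<Longrightarrow> q * (1 - F q ^ n) \<le> P"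
  shows "real n * (\<integral>y. capped_surplus T y * F y ^ (n - 1) \<partial>M) \<le>
    F T ^ n * ((1 / (SUP c\<in>{0..1}. g_fun n lam c) + a_coeff n lam) * P)"
proof -
  interpret t: bounded_regular_dist "trunc T" "trunc_pdf T" "D \<inter> {..T}" lam n T
    by (intro bounded_regular_dist.intro regular_trunc T bounded_regular_dist_axioms.intro) (use n_ge2 in auto)
  have Ft: "cdf (trunc T) y = F y / F T" if "y \<le> T" for y
    using that by (simp add: cdf_trunc[OF T] min_def)
  define g where "g y = max 0 (t.phi y) * (real n * cdf (trunc T) y ^ (n - 1))" for y
  have [measurable]: "g \<in> borel_measurable borel" unfolding g_def by measurable
  have "(\<integral>y. g y \<partial>trunc T) = (\<integral>y. (indicator {..T} y / F T) *\<^sub>R g y \<partial>M)"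
    unfolding trunc_eq[OF T] by (rule integral_density) (use T in auto)
  also have "\<dots> = (\<integral>y. real n / F T ^ n * (capped_surplus T y * F y ^ (n - 1)) \<partial>M)"
  proof (rule integral_cong_AE)
    show "AE y in M. (indicator {..T} y / F T) *\<^sub>R g y = real n / F T ^ n * (capped_surplus T y * F y ^ (n - 1))"
      using AE_D
    proof eventually_elim
      case (elim y)
      show ?case
      proof (cases "y \<le> T")
        case True
        have "t.phi y = trunc_virtual T y"
          using True T f_pos[OF elim]
          by (simp add: t.phi_def t.psi_def Ft trunc_virtual_def trunc_pdf_def field_simps)
        moreover have "F T ^ n = F T * F T ^ (n - 1)"
          using n_ge2 by (simp flip: power_Suc)
        ultimately show ?thesis using True T
          by (simp add: g_def Ft capped_surplus_def power_divide)
      qed (simp add: capped_surplus_def)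
    qed
  qed measurable
  also have "\<dots> = real n / F T ^ n * (\<integral>y. capped_surplus T y * F y ^ (n - 1) \<partial>M)" by simp
  finally have eq: "(\<integral>y. max 0 (t.phi y) * (real n * cdf (trunc T) y ^ (n - 1)) \<partial>trunc T)
      = real n / F T ^ n * (\<integral>y. capped_surplus T y * F y ^ (n - 1) \<partial>M)"
    unfolding g_def .
  have "real n / F T ^ n * (\<integral>y. capped_surplus T y * F y ^ (n - 1) \<partial>M)
     \<le> (1 / (SUP c\<in>{0..1}. g_fun n lam c) + a_coeff n lam) * P"
    unfolding eq[symmetric]
  proof (rule t.virtual_surplus_le)
    fix q assume q: "q \<in> D \<inter> {..T}"
    have "F q * F T \<le> F q" using F_ge0[of q] F_le1[of T] by (intro mult_left_le) auto
    hence "F q \<le> F q / F T" using T by (simp add: pos_le_divide_eq)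
    hence "F q ^ n \<le> cdf (trunc T) q ^ n"
      using q F_ge0 by (intro power_mono) (auto simp: Ft)
    hence "q * (1 - cdf (trunc T) q ^ n) \<le> q * (1 - F q ^ n)"
      using q D_nonneg by (intro mult_left_mono) auto
    also have "\<dots> \<le> P" using q by (intro P) auto
    finally show "q * (1 - cdf (trunc T) q ^ n) \<le> P" .
  qed
  thus ?thesis using T by (simp add: field_simps)
qed

text \<open>The cutoff is removed by dominated convergence along integer \<open>T\<close>, the
  integrable total serving as the dominating function. The limit bound is uniform because
  \<open>F T ^ n\<close> is at most 1.\<close>

lemma expected_revenue_le:
  assumes P: "\<And>q. q \<in> D \<Longrightarrow> q * (1 - F q ^ n) \<le> P" and P0: "0 \<le> P"
  shows "expected_revenue M n p \<le> (1 / (SUP c\<in>{0..1}. g_fun n lam c) + a_coeff n lam) * P"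
proof -
  define K where "K = (1 / (SUP c\<in>{0..1}. g_fun n lam c) + a_coeff n lam) * P"
  have K0: "0 \<le> K" unfolding K_def
    using Sup_g_fun_pos[OF lam_pos lam_le1 n_ge2] a_coeff_nonneg[OF lam_pos lam_le1 n_ge2] P0 by simp
  have lim: "(\<lambda>k. \<integral>v. total v * cutoff (real k) v \<partial>V) \<longlonglongrightarrow> (\<integral>v. total v \<partial>V)"
  proof (rule integral_dominated_convergence)
    show "integrable V (\<lambda>v. \<bar>total v\<bar>)" using integrable_total by simp
    show "AE v in V. (\<lambda>k. total v * cutoff (real k) v) \<longlonglongrightarrow> total v"
    proof (rule AE_I2)
      fix v
      obtain N :: nat where N: "Max (insert 0 (v ` {..<n})) \<le> real N" using real_arch_simple by blast
      have "\<forall>\<^sub>F k in sequentially. total v * cutoff (real k) v = total v"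
        using eventually_ge_at_top[of N]
      proof eventually_elim
        case (elim k)
        have "v j \<le> real k" if "j < n" for j
        proof -
          have "v j \<le> Max (insert 0 (v ` {..<n}))" using that by (intro Max_ge) auto
          thus ?thesis using N elim by linarith
        qed
        thus ?case by (simp add: cutoff_eq)
      qed
      thus "(\<lambda>k. total v * cutoff (real k) v) \<longlonglongrightarrow> total v" by (rule tendsto_eventually)
    qed
    show "AE v in V. norm (total v * cutoff (real k) v) \<le> \<bar>total v\<bar>" for k
      by (intro AE_I2) (simp add: cutoff_eq)
    show "total \<in> borel_measurable V" by (rule borel_measurable_integrable[OF integrable_total])
    thus "(\<lambda>v. total v * cutoff (real k) v) \<in> borel_measurable V" for k
      by (intro borel_measurable_times cutoff_measurable)
  qed
  have "\<forall>\<^sub>F k in sequentially. 0 < F (real k)"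
    using order_tendstoD(1)[OF cdf_lim_infty_prob, of 0] by simp
  hence "\<forall>\<^sub>F k in sequentially. (\<integral>v. total v * cutoff (real k) v \<partial>V) \<le> K"
  proof eventually_elim
    case (elim k)
    have "(\<integral>v. total v * cutoff (real k) v \<partial>V) \<le> F (real k) ^ n * K"
      using cutoff_revenue_le[of "real k"] capped_surplus_le[OF elim P] unfolding K_def by linarith
    also have "\<dots> \<le> K"
      using K0 F_ge0 F_le1 by (intro mult_left_le_one_le) (auto simp: power_le_one)
    finally show ?case .
  qed
  hence "(\<integral>v. total v \<partial>V) \<le> K"
    by (rule tendsto_upperbound[OF lim]) simp
  thus ?thesis by (simp add: expected_revenue_def valuations_def K_def)
qed

end

theorem theorem5p1:
  fixes M :: "real measure" and f :: "real \<Rightarrow> real" and D :: "real set"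
    and lam :: real and n :: nat
  assumes "0 < lam" and "lam \<le> 1"
    and "lambda_regular lam M f D"
    and "2 \<le> n"
  shows "APX M D n \<le> ereal (1 / (SUP c\<in>{0..1}. g_fun n lam c) + a_coeff n lam)"
proof -
  interpret regular_dist M f D lam
    using assms by unfold_locales (auto simp: lambda_regular_def)
  define K where "K = 1 / (SUP c\<in>{0..1}. g_fun n lam c) + a_coeff n lam"
  have K0: "0 \<le> K" unfolding K_def
    using Sup_g_fun_pos[of lam n] a_coeff_nonneg[of lam n] assms by simp
  \<comment> \<open>The median price earns a positive revenue, so the denominator of
    \<open>APX\<close> is positive.\<close>
  obtain q where q: "q \<in> D" "F q = 1/2" using ex_quantile[of "1/2"] by auto
  have "F 0 = 0" by (rule F_eq0) (rule D_nonneg)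
  hence "0 < q" using q D_nonneg[OF q(1)] by (cases "q = 0") auto
  moreover have "(1/2 :: real) ^ n < 1" using assms by (intro power_less_one_iff[THEN iffD2]) auto
  ultimately have q_pos: "0 < q * (1 - F q ^ n)" unfolding q(2) by simp
  have price: "ereal (y * (1 - F y ^ n)) \<le> Price M D n" if "y \<in> D" for y
    unfolding Price_def by (rule SUP_upper[OF that])
  have "APX M D n \<le> ereal K"
  proof (cases "Price M D n")
    case (real P)
    have P: "y * (1 - F y ^ n) \<le> P" if "y \<in> D" for y using price[OF that] real by simp
    have P0: "0 < P" using q_pos P[OF q(1)] by linarith
    have "Myerson M D n \<le> ereal (K * P)"
      unfolding Myerson_def
    proof (rule SUP_least, safe)
      fix x p assume "truthful_auction M D n x p"
      then interpret truthful_dist M f D lam n x p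
        using assms by unfold_locales
      show "ereal (expected_revenue M n p) \<le> ereal (K * P)"
        using expected_revenue_le[of P] P P0 by (simp add: K_def)
    qed
    thus ?thesis
      unfolding APX_def real using P0 by (subst ereal_divide_le_pos) (auto simp: mult.commute)
  next
    \<comment> \<open>In \<open>ereal\<close> a quotient by infinity is 0.\<close>
    case PInf
    thus ?thesis using K0 by (simp add: APX_def)
  next
    case MInf
    thus ?thesis using price[OF q(1)] by simp
  qed
  thus ?thesis by (simp add: K_def)
qed

end
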